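(* One has $W^*(n,4)=n+4$ for $n\in\{4,5\}$, and $W^*(n,5)=n+6$ for $4\le n\le 9$. Consequently, \[ I(n,5)=n^2+n+4\quad (n=4,5),\qquad I(n,6)=n^2+n+6\quad (4\le n\le 9). \]
   Context: $W^*(n,m)$ denotes the minimum internal wall length of a tiling of the square $[0,n]^2$ by $m$ axis-aligned rectangles with integer sides (integer corners) and pairwise distinct dimension pairs (unordered pairs $\{a,b\}$ of side lengths). The internal wall length of a tiling is the total length of the boundaries between tiles inside the square (each unit segment separating two tiles counted once). $I(n,k)$ is the minimum internal interface over all partitions of the cube $[0,n]^3$ into $k$ axis-aligned boxes with integer corners whose dimension multisets are pairwise distinct; the internal interface of a partition is the total area of the boundary between pieces inside the cube (each unit square separating two pieces counted once). *)

theory Defs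
  imports "HOL-Analysis.Analysis"
begin

definition int_box :: "(real ^ 'd) set \<Rightarrow> bool" where
  "int_box K \<longleftrightarrow>
     (\<exists>a b :: int ^ 'd. (\<forall>i. a $ i < b $ i) \<and>
        K = cbox (\<chi> i. of_int (a $ i)) (\<chi> i. of_int (b $ i)))"

definition tiling :: "nat \<Rightarrow> (real ^ 'd) set set \<Rightarrow> bool" where
  "tiling n T \<longleftrightarrow> T division_of cbox 0 (\<chi> i. real n) \<and> (\<forall>K\<in>T. int_box K)"

definition dims :: "(real ^ 'd) set \<Rightarrow> real multiset" where
  "dims K = {# interval_upperbound K $ i - interval_lowerbound K $ i. i \<in># mset_set UNIV #}"

definition distinct_dims :: "(real ^ 'd) set set \<Rightarrow> bool" where
  "distinct_dims T \<longleftrightarrow> inj_on dims T"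

text \<open>
  A unit facet is a unit cube of the integer lattice of dimension one less than the ambient
  space: a unit segment in the plane, a unit square in space. The corner \<open>p\<close> is its least
  vertex and \<open>k\<close> is the coordinate direction orthogonal to it.
\<close>

definition unit_facet :: "(real ^ 'd) set \<Rightarrow> bool" where
  "unit_facet F \<longleftrightarrow>
     (\<exists>(p :: int ^ 'd) k.
        F = cbox (\<chi> i. of_int (p $ i)) (\<chi> i. of_int (p $ i) + (if i = k then 0 else 1)))"

text \<open>
  The total measure (length in the plane, area in space) of the boundaries between pieces, as
  the number of unit facets that separate two different pieces. Facets on the boundary of the
  big cube lie in a single piece and so do not count.
\<close>

definition interface :: "(real ^ 'd) set set \<Rightarrow> nat" where
  "interface T = card {F. unit_facet F \<and> (\<exists>K\<in>T. \<exists>L\<in>T. K \<noteq> L \<and> F \<subseteq> K \<inter> L)}"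

text \<open>
  On \<^typ>\<open>nat\<close>, the infimum of a nonempty set is its minimum, and the infimum of the empty set
  is 0; hence an equation with a positive right-hand side also says that the minimum exists.
\<close>

definition W_star :: "nat \<Rightarrow> nat \<Rightarrow> nat" where
  "W_star n m =
     Inf {interface T | T :: (real ^ 2) set set. tiling n T \<and> card T = m \<and> distinct_dims T}"

definition I_min :: "nat \<Rightarrow> nat \<Rightarrow> nat" where
  "I_min n k =
     Inf {interface T | T :: (real ^ 3) set set. tiling n T \<and> card T = k \<and> distinct_dims T}"

end

theory Submission
  imports Defs
begin

text \<open>
  The interface of a tiling is governed by the sides of its pieces alone (\<open>interface_eq\<close>): in the
  plane the wall length is the sum of the semiperimeters minus \<open>2 n\<close>, and in space the interface
  is the sum of half the surface areas minus \<open>3 n\<^sup>2\<close>. Once a tiling is known to cover each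
  integer cell exactly once, everything becomes a statement about finite exact covers of a grid.

  In the plane (\<open>partition2_perimeter_lower\<close>), a horizontally and a vertically spanning rectangle
  cannot coexist in a nontrivial dissection. If no rectangle spans the square at all, then every row
  and every column is cut and the wall length is at least \<open>2 n\<close>, which suffices unless there are five
  rectangles and \<open>n\<close> is 4 or 5. Otherwise a spanning
  strip of height \<open>h\<close> is split off, and the other three or four rectangles of distinct shapes have
  total area \<open>n (n - h)\<close>. There are few small shapes: with semiperimeters at least 2, 3, 4, ..., convexity
  bounds the area by the semiperimeter, and with areas at least 1, 2, 3, 4 a remainder of height 1 is
  impossible for \<open>n \<le> 9\<close>. Together with a separate estimate for a remainder of height 2, this leaves no
  dissection with a shorter wall; the same convexity bound for five shapes settles \<open>n = 4, 5\<close>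
  without a spanning rectangle.

  In space (\<open>partition3_surface_lower\<close>), the facets parallel to a direction are the walls of the
  slices orthogonal to it, and each nontrivial slice contributes at least \<open>n\<close>. If some direction is
  spanned by no box, all lines in that direction are cut, which costs \<open>n\<^sup>2\<close>, and the interface is
  small only for a full slab of height \<open>n - 1\<close> on one nontrivial layer of height 1, in which case
  the planar bound applies to the layer. If every direction is spanned by some box, then all slices
  in all directions are nontrivial, some of them with at least three pieces, and the interface is at
  least \<open>3 (n\<^sup>2 + 1) / 2\<close>, which is enough.

  Both bounds are attained: in the plane by explicit dissections (\<open>rectangles_4\<close>, \<open>rectangles_5\<close>),
  in space by such a layer with a slab on top (\<open>cube_tiling_of_rectangles\<close>).
\<close>

section \<open>Exact covers of a square grid\<close>

text \<open>
  The boxes \<open>X i \<times> Y i\<close> cover every cell of the grid \<open>G \<times> G\<close> exactly once. A side is an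
  arbitrary nonempty set of coordinates: contiguity is never needed for the lower bounds, so
  the lengths of the sides are cardinalities and the two directions are interchangeable.
\<close>

definition partition2 :: "'g set \<Rightarrow> 'i set \<Rightarrow> ('i \<Rightarrow> 'g set) \<Rightarrow> ('i \<Rightarrow> 'g set) \<Rightarrow> bool" where
  "partition2 G I X Y \<longleftrightarrow> finite G \<and> finite I \<and>
     (\<forall>i\<in>I. X i \<subseteq> G \<and> Y i \<subseteq> G \<and> X i \<noteq> {} \<and> Y i \<noteq> {}) \<and>
     (\<forall>x\<in>G. \<forall>y\<in>G. \<exists>!i. i \<in> I \<and> x \<in> X i \<and> y \<in> Y i)"

lemma partition2_swap:
  assumes "partition2 G I X Y" shows "partition2 G I Y X"
proof -
  have "\<exists>!i. i \<in> I \<and> x \<in> Y i \<and> y \<in> X i" if "x \<in> G" "y \<in> G" for x y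
  proof -
    have "\<exists>!i. i \<in> I \<and> y \<in> X i \<and> x \<in> Y i" using assms that unfolding partition2_def by blast
    then show ?thesis by blast
  qed
  then show ?thesis using assms by (simp add: partition2_def)
qed

lemma partition2_cell_unique:
  assumes "partition2 G I X Y" "i \<in> I" "j \<in> I" "x \<in> X i" "x \<in> X j" "y \<in> Y i" "y \<in> Y j"
  shows "i = j"
proof -
  have "x \<in> G" "y \<in> G" using assms unfolding partition2_def by blast+
  then have "\<exists>!i. i \<in> I \<and> x \<in> X i \<and> y \<in> Y i" using assms(1) unfolding partition2_def by blast
  then show ?thesis using assms by blast
qed

lemma partition2_cell_covered:
  assumes "partition2 G I X Y" "x \<in> G" "y \<in> G"
  obtains i where "i \<in> I" "x \<in> X i" "y \<in> Y i"
proof -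
  have "\<exists>!i. i \<in> I \<and> x \<in> X i \<and> y \<in> Y i" using assms unfolding partition2_def by blast
  then show ?thesis using that by blast
qed

lemma partition2_sides:
  assumes "partition2 G I X Y" "i \<in> I"
  shows "X i \<subseteq> G" "Y i \<subseteq> G" "X i \<noteq> {}" "Y i \<noteq> {}"
  using assms by (simp_all add: partition2_def)

lemma partition2_full:
  assumes P: "partition2 G I X Y" and i: "i \<in> I" "X i = G" and j: "j \<in> I" "Y j = G"
  shows "I = {i} \<and> Y i = G"
proof -
  obtain x y where xy: "x \<in> X j" "y \<in> Y i"
    using partition2_sides[OF P j(1)] partition2_sides[OF P i(1)] by auto
  then have "x \<in> G" "y \<in> G"
    using partition2_sides[OF P j(1)] partition2_sides[OF P i(1)] by auto
  then have "i = j" using partition2_cell_unique[OF P i(1) j(1), of x y] xy i j by simp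
  have "k = i" if k: "k \<in> I" for k
  proof -
    obtain x' y' where "x' \<in> X k" "y' \<in> Y k" using partition2_sides[OF P k] by auto
    then show ?thesis
      using partition2_cell_unique[OF P k i(1), of x' y'] partition2_sides[OF P k] i j \<open>i = j\<close> by auto
  qed
  then have "I = {i}" using i(1) by blast
  with j \<open>i = j\<close> show ?thesis by simp
qed

lemma sum_card_double_count:
  assumes "finite G" "finite I" "\<forall>i\<in>I. A i \<subseteq> G"
  shows "(\<Sum>i\<in>I. card (A i)) = (\<Sum>x\<in>G. card {i\<in>I. x \<in> A i})"
proof -
  have "(\<Sum>i\<in>I. card (A i)) = (\<Sum>i\<in>I. \<Sum>x\<in>G. if x \<in> A i then 1 else 0)"
  proof (rule sum.cong)
    fix i assume "i \<in> I"
    then have "A i \<subseteq> G" "G \<inter> {x. x \<in> A i} = A i" using assms by auto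
    then show "card (A i) = (\<Sum>x\<in>G. if x \<in> A i then 1 else 0)"
      using assms(1) by (simp add: sum.If_cases Int_absorb1)
  qed simp
  also have "\<dots> = (\<Sum>x\<in>G. \<Sum>i\<in>I. if x \<in> A i then 1 else 0)" by (rule sum.swap)
  also have "\<dots> = (\<Sum>x\<in>G. card {i\<in>I. x \<in> A i})"
    using assms(2) by (intro sum.cong) (auto simp: sum.If_cases Int_def)
  finally show ?thesis .
qed

lemma partition2_area:
  assumes "partition2 G I X Y"
  shows "(\<Sum>i\<in>I. card (X i) * card (Y i)) = card G * card G"
proof -
  have "(\<Sum>i\<in>I. card (X i) * card (Y i)) = (\<Sum>i\<in>I. card (X i \<times> Y i))"
    by (simp add: card_cartesian_product)
  also have "\<dots> = (\<Sum>z\<in>G \<times> G. card {i\<in>I. z \<in> X i \<times> Y i})"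
    using assms unfolding partition2_def by (intro sum_card_double_count) auto
  also have "\<dots> = (\<Sum>z\<in>G \<times> G. 1)"
  proof (rule sum.cong)
    fix z assume "z \<in> G \<times> G"
    then have "\<exists>!i. i \<in> I \<and> fst z \<in> X i \<and> snd z \<in> Y i"
      using assms unfolding partition2_def by (simp add: mem_Times_iff)
    then have "\<exists>!i. i \<in> I \<and> z \<in> X i \<times> Y i" by (simp add: mem_Times_iff)
    then obtain i where "{i\<in>I. z \<in> X i \<times> Y i} = {i}" by blast
    then show "card {i\<in>I. z \<in> X i \<times> Y i} = 1" by simp
  qed simp
  finally show ?thesis by (simp add: card_cartesian_product)
qed

lemma card_ge_2I:
  assumes "finite A" "a \<in> A" "b \<in> A" "a \<noteq> b" shows "2 \<le> card A"
proof -
  have "card {a, b} \<le> card A" using assms by (intro card_mono) auto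
  then show ?thesis using assms by simp
qed

lemma card_ge_3I:
  assumes "finite A" "a \<in> A" "b \<in> A" "c \<in> A" "a \<noteq> b" "a \<noteq> c" "b \<noteq> c" shows "3 \<le> card A"
proof -
  have "card {a, b, c} \<le> card A" using assms by (intro card_mono) auto
  then show ?thesis using assms by simp
qed

lemma partition2_row_pos:
  assumes P: "partition2 G I X Y" and y: "y \<in> G"
  shows "1 \<le> card {i\<in>I. y \<in> Y i}"
proof -
  obtain i where "i \<in> I" "y \<in> Y i" by (rule partition2_cell_covered[OF P y y])
  moreover have "finite I" using P by (simp add: partition2_def)
  ultimately show ?thesis by (auto simp: Suc_le_eq card_gt_0_iff)
qed

text \<open>
  In a row that meets a rectangle not spanning the full width, that rectangle has a neighbour.
\<close>

lemma partition2_row_cut: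
  assumes P: "partition2 G I X Y" and i: "i \<in> I" "X i \<noteq> G" "y \<in> Y i"
  shows "2 \<le> card {i\<in>I. y \<in> Y i}"
proof -
  obtain x where "x \<in> G" "x \<notin> X i" using P i unfolding partition2_def by blast
  have "y \<in> G" using P i unfolding partition2_def by blast
  obtain j where "j \<in> I" "x \<in> X j" "y \<in> Y j"
    by (rule partition2_cell_covered[OF P \<open>x \<in> G\<close> \<open>y \<in> G\<close>])
  with \<open>x \<notin> X i\<close> have "j \<noteq> i" by auto
  moreover have "finite I" using P by (simp add: partition2_def)
  ultimately show ?thesis using i \<open>j \<in> I\<close> \<open>y \<in> Y j\<close> by (intro card_ge_2I[of _ i j]) auto
qed

lemma partition2_sum_rows:
  assumes "partition2 G I X Y"
  shows "(\<Sum>i\<in>I. card (Y i)) = (\<Sum>y\<in>G. card {i\<in>I. y \<in> Y i})"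
  using assms unfolding partition2_def by (intro sum_card_double_count) auto

lemma partition2_sum_ge:
  assumes P: "partition2 G I X Y"
  shows "card G \<le> (\<Sum>i\<in>I. card (Y i))"
proof -
  have "(\<Sum>y\<in>G. 1) \<le> (\<Sum>y\<in>G. card {i\<in>I. y \<in> Y i})"
    using partition2_row_pos[OF P] by (intro sum_mono) auto
  then show ?thesis by (simp add: partition2_sum_rows[OF P])
qed

lemma partition2_sum_ge_Suc:
  assumes P: "partition2 G I X Y" and i: "i \<in> I" "X i \<noteq> G"
  shows "card G + 1 \<le> (\<Sum>i\<in>I. card (Y i))"
proof -
  obtain y where y: "y \<in> Y i" "y \<in> G" using P i unfolding partition2_def by blast
  have fin: "finite G" using P by (simp add: partition2_def)
  have "(\<Sum>y\<in>G. 1) < (\<Sum>y\<in>G. card {i\<in>I. y \<in> Y i})"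
  proof (rule sum_strict_mono_ex1[OF fin])
    show "\<forall>y\<in>G. 1 \<le> card {i\<in>I. y \<in> Y i}" using partition2_row_pos[OF P] by blast
    have "1 < card {i\<in>I. y \<in> Y i}" using partition2_row_cut[OF P i y(1)] by linarith
    then show "\<exists>y\<in>G. 1 < card {i\<in>I. y \<in> Y i}" using y by blast
  qed
  then show ?thesis by (simp add: partition2_sum_rows[OF P])
qed

lemma partition2_sum_ge_double:
  assumes P: "partition2 G I X Y" and cut: "\<forall>i\<in>I. X i \<noteq> G"
  shows "2 * card G \<le> (\<Sum>i\<in>I. card (Y i))"
proof -
  have "(\<Sum>y\<in>G. 2) \<le> (\<Sum>y\<in>G. card {i\<in>I. y \<in> Y i})"
  proof (rule sum_mono)
    fix y assume "y \<in> G"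
    obtain i where "i \<in> I" "y \<in> Y i" by (rule partition2_cell_covered[OF P \<open>y \<in> G\<close> \<open>y \<in> G\<close>])
    then show "2 \<le> card {i\<in>I. y \<in> Y i}" using partition2_row_cut[OF P] cut by blast
  qed
  then show ?thesis by (simp add: partition2_sum_rows[OF P])
qed

lemma partition2_cut_cases:
  assumes P: "partition2 G I X Y" and "2 \<le> card I"
  shows "(\<forall>i\<in>I. X i \<noteq> G) \<or> (\<forall>i\<in>I. Y i \<noteq> G)"
proof (rule ccontr)
  assume "\<not> ?thesis"
  then obtain i j where "i \<in> I" "X i = G" "j \<in> I" "Y j = G" by blast
  then have "I = {i}" using partition2_full[OF P] by blast
  with assms(2) show False by simp
qed

text \<open>
  The sum of all \<open>card (X i) + card (Y i)\<close> is the wall length plus \<open>2 * card G\<close>. So a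
  nontrivial dissection of a square has wall length at least its side, and at least one more with
  three or more pieces (\<open>partition2_perimeter_3\<close>).
\<close>

lemma partition2_perimeter_2:
  assumes P: "partition2 G I X Y" and "2 \<le> card I"
  shows "3 * card G \<le> (\<Sum>i\<in>I. card (X i) + card (Y i))"
  using partition2_cut_cases[OF assms]
    partition2_sum_ge_double[OF P] partition2_sum_ge[OF P]
    partition2_sum_ge_double[OF partition2_swap[OF P]] partition2_sum_ge[OF partition2_swap[OF P]]
  by (auto simp: sum.distrib)

lemma partition2_perimeter_3_aux:
  assumes P: "partition2 G I X Y" and c: "3 \<le> card I" and cut: "\<forall>i\<in>I. X i \<noteq> G"
  shows "3 * card G + 1 \<le> (\<Sum>i\<in>I. card (X i) + card (Y i))"
proof (cases "\<forall>i\<in>I. Y i = G")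
  case True
  obtain i where "i \<in> I" using c by fastforce
  have "card G > 0" using P \<open>i \<in> I\<close> unfolding partition2_def by (auto simp: card_gt_0_iff)
  have "(\<Sum>i\<in>I. card (Y i)) = card I * card G" using True by simp
  also have "\<dots> \<ge> 3 * card G" using c by simp
  finally show ?thesis
    using partition2_sum_ge[OF partition2_swap[OF P]] \<open>card G > 0\<close> by (simp add: sum.distrib)
next
  case False
  then obtain i where "i \<in> I" "Y i \<noteq> G" by blast
  then show ?thesis
    using partition2_sum_ge_Suc[OF partition2_swap[OF P] \<open>i \<in> I\<close> \<open>Y i \<noteq> G\<close>]
      partition2_sum_ge_double[OF P cut] by (simp add: sum.distrib)
qed

lemma partition2_perimeter_3:
  assumes P: "partition2 G I X Y" and c: "3 \<le> card I"
  shows "3 * card G + 1 \<le> (\<Sum>i\<in>I. card (X i) + card (Y i))"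
proof -
  have "2 \<le> card I" using c by simp
  then show ?thesis
    using partition2_cut_cases[OF P] partition2_perimeter_3_aux[OF P c]
      partition2_perimeter_3_aux[OF partition2_swap[OF P] c]
    by (auto simp: add.commute)
qed

section \<open>Small rectangles of distinct shapes\<close>

text \<open>
  Semiperimeters and areas up to 3 determine a rectangle: the shapes are \<open>1 \<times> 1\<close> and \<open>1 \<times> 2\<close>,
  respectively \<open>1 \<times> 1\<close>, \<open>1 \<times> 2\<close> and \<open>1 \<times> 3\<close>. Hence in a list of distinct shapes sorted by
  semiperimeter (area), the first entries are at least 2, 3, 4 (1, 2, 3, 4).
\<close>

lemma pair_eq_if_semiperimeter:
  fixes p q p' q' :: nat
  assumes "1 \<le> p" "1 \<le> q" "1 \<le> p'" "1 \<le> q'" "p + q = p' + q'" "p + q \<le> 3"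
  shows "{#p, q#} = {#p', q'#}"
proof -
  have "(p = 1 \<and> q = 1 \<and> p' = 1 \<and> q' = 1) \<or> (p = p' \<and> q = q') \<or> (p = q' \<and> q = p')"
    using assms by arith
  then show ?thesis by auto
qed

lemma factors_le_3:
  fixes p q :: nat
  assumes "1 \<le> p" "1 \<le> q" "p * q \<le> 3"
  shows "p = 1 \<or> q = 1"
proof (rule ccontr)
  assume "\<not> ?thesis"
  then have "2 * 2 \<le> p * q" using assms by (intro mult_le_mono) auto
  with assms show False by simp
qed

lemma pair_eq_if_area:
  fixes p q p' q' :: nat
  assumes "1 \<le> p" "1 \<le> q" "1 \<le> p'" "1 \<le> q'" "p * q = p' * q'" "p * q \<le> 3"
  shows "{#p, q#} = {#p', q'#}"
  using factors_le_3[of p q] factors_le_3[of p' q'] assms by (auto simp: add_mset_commute)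

lemma sorted_enumeration:
  fixes f :: "'a \<Rightarrow> nat"
  assumes "finite J"
  obtains xs where "set xs = J" "distinct xs" "sorted (map f xs)" "length xs = card J"
proof -
  obtain ys where "set ys = J" "distinct ys" using finite_distinct_list[OF assms] by blast
  moreover have "length ys = card J" using calculation distinct_card by metis
  ultimately show ?thesis
    using that[of "sort_key f ys"] by simp
qed

lemma sorted_enumeration_3:
  fixes f :: "'a \<Rightarrow> nat"
  assumes "card J = 3"
  obtains a b c where "J = {a, b, c}" "distinct [a, b, c]" "f a \<le> f b" "f b \<le> f c"
proof -
  have "finite J" using assms by (metis card.infinite zero_neq_numeral)
  then obtain xs where xs: "set xs = J" "distinct xs" "sorted (map f xs)" "length xs = 3"
    using sorted_enumeration[of J f] assms by metis
  then obtain a b c where "xs = [a, b, c]"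
    by (auto simp: length_Suc_conv numeral_eq_Suc)
  then show ?thesis using that[of a b c] xs by auto
qed

lemma sorted_enumeration_4:
  fixes f :: "'a \<Rightarrow> nat"
  assumes "card J = 4"
  obtains a b c d where "J = {a, b, c, d}" "distinct [a, b, c, d]"
    "f a \<le> f b" "f b \<le> f c" "f c \<le> f d"
proof -
  have "finite J" using assms by (metis card.infinite zero_neq_numeral)
  then obtain xs where xs: "set xs = J" "distinct xs" "sorted (map f xs)" "length xs = 4"
    using sorted_enumeration[of J f] assms by metis
  then obtain a b c d where "xs = [a, b, c, d]"
    by (auto simp: length_Suc_conv numeral_eq_Suc)
  then show ?thesis using that[of a b c d] xs by auto
qed

lemma sorted_enumeration_5:
  fixes f :: "'a \<Rightarrow> nat"
  assumes "card J = 5"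
  obtains a b c d e where "J = {a, b, c, d, e}" "distinct [a, b, c, d, e]"
    "f a \<le> f b" "f b \<le> f c" "f c \<le> f d" "f d \<le> f e"
proof -
  have "finite J" using assms by (metis card.infinite zero_neq_numeral)
  then obtain xs where xs: "set xs = J" "distinct xs" "sorted (map f xs)" "length xs = 5"
    using sorted_enumeration[of J f] assms by metis
  then obtain a b c d e where "xs = [a, b, c, d, e]"
    by (auto simp: length_Suc_conv numeral_eq_Suc)
  then show ?thesis using that[of a b c d e] xs by auto
qed

lemma four_mult_le_square: "4 * (p * q) \<le> (p + q)\<^sup>2" for p q :: nat
proof -
  have "int (4 * (p * q)) \<le> int ((p + q)\<^sup>2)"
    using zero_le_power2[of "int p - int q"] by (simp add: power2_eq_square algebra_simps)
  then show ?thesis by linarith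
qed

text \<open>
  A family of rectangles with positive integer sides \<open>p i\<close>, \<open>q i\<close>, no two of the same shape up
  to exchanging the sides. Within the locale, \<open>s\<close> is the semiperimeter and \<open>ar\<close> the area.
\<close>

locale distinct_pairs =
  fixes J :: "'a set" and p q :: "'a \<Rightarrow> nat"
  assumes pos: "\<And>i. i \<in> J \<Longrightarrow> 1 \<le> p i \<and> 1 \<le> q i"
    and distinct_shapes: "inj_on (\<lambda>i. {#p i, q i#}) J"
begin

abbreviation "s i \<equiv> p i + q i"
abbreviation "ar i \<equiv> p i * q i"

lemma semi_ge_2: "i \<in> J \<Longrightarrow> 2 \<le> s i"
  using pos[of i] by simp

lemma semi_step:
  assumes "i \<in> J" "j \<in> J" "i \<noteq> j" "s i \<le> s j" "m \<le> s i" "m \<le> 3"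
  shows "Suc m \<le> s j"
proof (rule ccontr)
  assume "\<not> Suc m \<le> s j"
  then have "s i = s j" "s i \<le> 3" using assms by auto
  then have "{#p i, q i#} = {#p j, q j#}"
    using pos[of i] pos[of j] assms by (intro pair_eq_if_semiperimeter) auto
  with assms distinct_shapes show False by (auto dest: inj_onD)
qed

lemma area_step:
  assumes "i \<in> J" "j \<in> J" "i \<noteq> j" "ar i \<le> ar j" "m \<le> ar i" "m \<le> 3"
  shows "Suc m \<le> ar j"
proof (rule ccontr)
  assume "\<not> Suc m \<le> ar j"
  then have "ar i = ar j" "ar i \<le> 3" using assms by auto
  then have "{#p i, q i#} = {#p j, q j#}"
    using pos[of i] pos[of j] assms by (intro pair_eq_if_area) auto
  with assms distinct_shapes show False by (auto dest: inj_onD)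
qed

lemma area_ge_1: "i \<in> J \<Longrightarrow> 1 \<le> ar i"
  using pos[of i] by simp

lemma area_sum_3:
  assumes "card J = 3" shows "6 \<le> (\<Sum>i\<in>J. ar i)"
proof -
  obtain a b c where J: "J = {a, b, c}" "distinct [a, b, c]" "ar a \<le> ar b" "ar b \<le> ar c"
    by (rule sorted_enumeration_3[OF assms])
  have "(\<Sum>i\<in>J. ar i) = ar a + (ar b + ar c)" using J by simp
  moreover have "1 \<le> ar a" using J area_ge_1 by blast
  moreover have "2 \<le> ar b" using area_step[of a b 1] calculation J by simp
  moreover have "3 \<le> ar c" using area_step[of b c 2] calculation J by simp
  ultimately show ?thesis by linarith
qed

lemma area_sum_4:
  assumes "card J = 4" shows "10 \<le> (\<Sum>i\<in>J. ar i)"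
proof -
  obtain a b c d where J: "J = {a, b, c, d}" "distinct [a, b, c, d]"
    "ar a \<le> ar b" "ar b \<le> ar c" "ar c \<le> ar d"
    by (rule sorted_enumeration_4[OF assms])
  have "(\<Sum>i\<in>J. ar i) = ar a + (ar b + (ar c + ar d))" using J by simp
  moreover have "1 \<le> ar a" using J area_ge_1 by blast
  moreover have "2 \<le> ar b" using area_step[of a b 1] calculation J by simp
  moreover have "3 \<le> ar c" using area_step[of b c 2] calculation J by simp
  moreover have "4 \<le> ar d" using area_step[of c d 3] calculation J by simp
  ultimately show ?thesis by linarith
qed

text \<open>
  The three lemmas below bound the total area by the total semiperimeter. Since \<open>4 p q \<le> (p + q)\<^sup>2\<close>
  and squaring is convex, for a fixed total the sum of the \<open>(s i)\<^sup>2\<close> is largest when all terms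
  but the greatest sit at their lower bounds \<open>2, 3, 4\<close> (and \<open>4\<close>, for five rectangles). The number
  \<open>t\<close> is what the total leaves for the greatest term, and \<open>13 = 2\<^sup>2 + 3\<^sup>2\<close>, \<open>29 = 13 + 4\<^sup>2\<close>,
  \<open>45 = 29 + 4\<^sup>2\<close>.
\<close>

lemma area_le_convex_3:
  assumes "card J = 3"
  shows "\<exists>t. (\<Sum>i\<in>J. s i) = 5 + t \<and> 4 \<le> t \<and> 4 * (\<Sum>i\<in>J. ar i) \<le> 13 + t\<^sup>2"
proof -
  obtain a b c where J: "J = {a, b, c}" "distinct [a, b, c]" "s a \<le> s b" "s b \<le> s c"
    by (rule sorted_enumeration_3[OF assms])
  have a: "2 \<le> s a" using J semi_ge_2 by blast
  have b: "3 \<le> s b" using semi_step[of a b 2] a J by simp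
  have c: "4 \<le> s c" using semi_step[of b c 3] b J by simp
  note * = a b c
  define a' b' where "a' = s a - 2" and "b' = s b - 3"
  then have e: "s a = 2 + a'" "s b = 3 + b'" using * by linarith+
  have "4 * (\<Sum>i\<in>J. ar i) \<le> (s a)\<^sup>2 + (s b)\<^sup>2 + (s c)\<^sup>2"
    using J four_mult_le_square[of "p a" "q a"] four_mult_le_square[of "p b" "q b"]
      four_mult_le_square[of "p c" "q c"] by simp
  also have "\<dots> \<le> 13 + (a' + b' + s c)\<^sup>2"
  proof -
    have "2 * a' \<le> s c * a'" "3 * b' \<le> s c * b'" using * by (intro mult_le_mono1; simp)+
    then show ?thesis unfolding e by (simp add: power2_eq_square algebra_simps)
  qed
  finally show ?thesis using J * e by (intro exI[of _ "a' + b' + s c"]) auto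
qed

lemma area_le_convex_4:
  assumes "card J = 4"
  shows "\<exists>t. (\<Sum>i\<in>J. s i) = 9 + t \<and> 4 \<le> t \<and> 4 * (\<Sum>i\<in>J. ar i) \<le> 29 + t\<^sup>2"
proof -
  obtain a b c d where J: "J = {a, b, c, d}" "distinct [a, b, c, d]"
    "s a \<le> s b" "s b \<le> s c" "s c \<le> s d"
    by (rule sorted_enumeration_4[OF assms])
  have a: "2 \<le> s a" using J semi_ge_2 by blast
  have b: "3 \<le> s b" using semi_step[of a b 2] a J by simp
  have c: "4 \<le> s c" using semi_step[of b c 3] b J by simp
  have de: "4 \<le> s d" using c J by linarith+
  note * = a b c de
  define a' b' c' where "a' = s a - 2" and "b' = s b - 3" and "c' = s c - 4"
  then have e: "s a = 2 + a'" "s b = 3 + b'" "s c = 4 + c'" using * by linarith+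
  have "4 * (\<Sum>i\<in>J. ar i) \<le> (s a)\<^sup>2 + (s b)\<^sup>2 + (s c)\<^sup>2 + (s d)\<^sup>2"
    using J four_mult_le_square[of "p a" "q a"] four_mult_le_square[of "p b" "q b"]
      four_mult_le_square[of "p c" "q c"] four_mult_le_square[of "p d" "q d"] by simp
  also have "\<dots> \<le> 29 + (a' + b' + c' + s d)\<^sup>2"
  proof -
    have "2 * a' \<le> s d * a'" "3 * b' \<le> s d * b'" "4 * c' \<le> s d * c'"
      using * by (intro mult_le_mono1; simp)+
    then show ?thesis unfolding e by (simp add: power2_eq_square algebra_simps)
  qed
  finally show ?thesis using J * e by (intro exI[of _ "a' + b' + c' + s d"]) auto
qed

lemma area_le_convex_5:
  assumes "card J = 5"
  shows "\<exists>t. (\<Sum>i\<in>J. s i) = 13 + t \<and> 4 \<le> t \<and> 4 * (\<Sum>i\<in>J. ar i) \<le> 45 + t\<^sup>2"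
proof -
  obtain a b c d e where J: "J = {a, b, c, d, e}" "distinct [a, b, c, d, e]"
    "s a \<le> s b" "s b \<le> s c" "s c \<le> s d" "s d \<le> s e"
    by (rule sorted_enumeration_5[OF assms])
  have a: "2 \<le> s a" using J semi_ge_2 by blast
  have b: "3 \<le> s b" using semi_step[of a b 2] a J by simp
  have c: "4 \<le> s c" using semi_step[of b c 3] b J by simp
  have de: "4 \<le> s d" "4 \<le> s e" using c J by linarith+
  note * = a b c de
  define a' b' c' d' where "a' = s a - 2" and "b' = s b - 3" and "c' = s c - 4" and "d' = s d - 4"
  then have eqs: "s a = 2 + a'" "s b = 3 + b'" "s c = 4 + c'" "s d = 4 + d'" using * by linarith+
  have "4 * (\<Sum>i\<in>J. ar i) \<le> (s a)\<^sup>2 + (s b)\<^sup>2 + (s c)\<^sup>2 + (s d)\<^sup>2 + (s e)\<^sup>2"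
    using J four_mult_le_square[of "p a" "q a"] four_mult_le_square[of "p b" "q b"]
      four_mult_le_square[of "p c" "q c"] four_mult_le_square[of "p d" "q d"]
      four_mult_le_square[of "p e" "q e"] by simp
  also have "\<dots> \<le> 45 + (a' + b' + c' + d' + s e)\<^sup>2"
  proof -
    have "2 * a' \<le> s e * a'" "3 * b' \<le> s e * b'" "4 * c' \<le> s e * c'" "4 * d' \<le> s e * d'"
      using * by (intro mult_le_mono1; simp)+
    then show ?thesis unfolding eqs by (simp add: power2_eq_square algebra_simps)
  qed
  finally show ?thesis using J * eqs by (intro exI[of _ "a' + b' + c' + d' + s e"]) auto
qed

text \<open>
  A \<open>p \<times> q\<close> rectangle with \<open>q \<le> 2\<close> has area at most \<open>2 (p + q) - 4\<close>, except that the unit square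
  exceeds this bound by one; and at most one member of the family is a unit square.
\<close>

lemma area_le_thin:
  assumes "finite J" and thin: "\<And>i. i \<in> J \<Longrightarrow> q i \<le> 2"
  shows "(\<Sum>i\<in>J. ar i) + 4 * card J \<le> 2 * (\<Sum>i\<in>J. s i) + 1"
proof -
  have le: "ar i + 4 \<le> 2 * s i + (if ar i = 1 then 1 else 0)" if "i \<in> J" for i
  proof -
    have "q i = 1 \<or> q i = 2" using pos[OF that] thin[OF that] by auto
    then show ?thesis using pos[OF that] by auto
  qed
  have "(\<Sum>i\<in>J. ar i + 4) \<le> (\<Sum>i\<in>J. 2 * s i + (if ar i = 1 then 1 else 0))"
    by (rule sum_mono) (rule le)
  moreover have "(\<Sum>i\<in>J. if ar i = 1 then 1 else 0 :: nat) = card {i\<in>J. ar i = 1}"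
    using \<open>finite J\<close> by (simp add: sum.If_cases Int_def)
  moreover have "card {i\<in>J. ar i = 1} \<le> 1"
  proof -
    have "i = j" if "i \<in> J" "j \<in> J" "ar i = 1" "ar j = 1" for i j
      using area_step[of i j 1] that by auto
    then show ?thesis using \<open>finite J\<close> by (auto simp: card_le_Suc0_iff_eq)
  qed
  ultimately have "(\<Sum>i\<in>J. ar i + 4) \<le> (\<Sum>i\<in>J. 2 * s i) + 1"
    unfolding sum.distrib by linarith
  then show ?thesis by (simp add: sum.distrib sum_distrib_left)
qed

end

section \<open>The perimeter bound in the plane\<close>

text \<open>
  A full strip of height \<open>h\<close> is removed from the \<open>n \<times> n\<close> square. The remaining area \<open>A\<close> would have
  to be filled with three rectangles of total semiperimeter \<open>5 + t\<close>; if the wall length of the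
  whole were below \<open>n + 4\<close>, then \<open>t\<close> would satisfy the stated bound.
\<close>

lemma no_small_remainder_3:
  fixes n h t A :: nat
  assumes n: "n = 4 \<or> n = 5" and h: "1 \<le> h" "h < n" and t: "t + h + 1 < 2 * n"
    and A: "A + n * h = n * n" "6 \<le> A" "4 * A \<le> 13 + t\<^sup>2"
  shows False
proof -
  have "t\<^sup>2 \<le> (2 * n - 2 - h)\<^sup>2" using t by (intro power_mono) auto
  then have A': "4 * A \<le> 13 + (2 * n - 2 - h)\<^sup>2" using A by linarith
  have "h = 1 \<or> h = 2 \<or> h = 3 \<or> h = 4" using n h by presburger
  then show False using n h A(1,2) A' by (elim disjE) simp_all
qed

text \<open>
  The same for four further rectangles of total semiperimeter \<open>9 + t\<close>, and wall length below
  \<open>n + 6\<close>. The convexity bound does not exclude a remainder of height 2 (for \<open>n = 8\<close> the shapes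
  \<open>1 \<times> 1\<close>, \<open>1 \<times> 2\<close>, \<open>2 \<times> 2\<close>, \<open>3 \<times> 3\<close> have area 16 and semiperimeter 15); there the
  bound for thin rectangles is decisive. A remainder of height 1 has area \<open>n \<le> 9 < 10\<close>.
\<close>

lemma no_small_remainder_4:
  fixes n h t A :: nat
  assumes n: "4 \<le> n" "n \<le> 9" and h: "1 \<le> h" "h < n" and t: "t + h + 3 < 2 * n" "4 \<le> t"
    and A: "A + n * h = n * n" "10 \<le> A" "4 * A \<le> 29 + t\<^sup>2"
    and thin: "n \<le> h + 2 \<Longrightarrow> A \<le> 2 * t + 3"
  shows False
proof -
  have "t\<^sup>2 \<le> (2 * n - 4 - h)\<^sup>2" using t by (intro power_mono) auto
  then have A': "4 * A \<le> 29 + (2 * n - 4 - h)\<^sup>2" using A by linarith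
  have "n = 4 \<or> n = 5 \<or> n = 6 \<or> n = 7 \<or> n = 8 \<or> n = 9" using n by presburger
  moreover have "h = 1 \<or> h = 2 \<or> h = 3 \<or> h = 4 \<or> h = 5 \<or> h = 6 \<or> h = 7 \<or> h = 8"
    using n h by presburger
  ultimately show False
    using h t A(1,2) A' thin by (elim disjE; hypsubst) (simp; fail)+
qed

text \<open>
  The numerical range considered: dissections of a square of side \<open>n\<close> into \<open>m\<close> rectangles, whose
  least wall length is \<open>n + c\<close>.
\<close>

definition small_case :: "nat \<Rightarrow> nat \<Rightarrow> nat \<Rightarrow> bool" where
  "small_case n m c \<longleftrightarrow> m = 4 \<and> c = 4 \<and> (n = 4 \<or> n = 5) \<or> m = 5 \<and> c = 6 \<and> 4 \<le> n \<and> n \<le> 9"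

lemma partition2_distinct_pairs:
  assumes "partition2 G I X Y" "inj_on (\<lambda>i. {#card (X i), card (Y i)#}) I" "J \<subseteq> I"
  shows "distinct_pairs J (\<lambda>i. card (X i)) (\<lambda>i. card (Y i))"
proof
  fix i assume "i \<in> J"
  then have i: "i \<in> I" using assms by blast
  have "finite G" using assms(1) by (simp add: partition2_def)
  then have "finite (X i)" "finite (Y i)"
    using partition2_sides[OF assms(1) i] finite_subset by metis+
  then show "1 \<le> card (X i) \<and> 1 \<le> card (Y i)"
    using partition2_sides[OF assms(1) i] by (simp add: Suc_le_eq card_gt_0_iff)
next
  show "inj_on (\<lambda>i. {#card (X i), card (Y i)#}) J" using assms inj_on_subset by blast
qed

lemma partition2_perimeter_spanning:
  assumes P: "partition2 G I X Y" and inj: "inj_on (\<lambda>i. {#card (X i), card (Y i)#}) I"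
    and small: "small_case (card G) (card I) c" and i: "i \<in> I" "X i = G"
  shows "3 * card G + c \<le> (\<Sum>i\<in>I. card (X i) + card (Y i))"
proof (rule ccontr)
  assume less: "\<not> ?thesis"
  define J n h A S where "J = I - {i}" and "n = card G" and "h = card (Y i)"
    and "A = (\<Sum>j\<in>J. card (X j) * card (Y j))" and "S = (\<Sum>j\<in>J. card (X j) + card (Y j))"
  have fin: "finite G" "finite I" "finite J" using P by (simp_all add: partition2_def J_def)
  interpret distinct_pairs J "\<lambda>i. card (X i)" "\<lambda>i. card (Y i)"
    by (rule partition2_distinct_pairs[OF P inj]) (simp add: J_def)
  have disj: "Y j \<subseteq> G - Y i" if "j \<in> J" for j
  proof -
    have j: "j \<in> I" "j \<noteq> i" using that by (auto simp: J_def)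
    obtain x where "x \<in> X j" using partition2_sides[OF P j(1)] by auto
    then show ?thesis
      using partition2_cell_unique[OF P j(1) i(1), of x] partition2_sides[OF P j(1)] j(2) i(2) by auto
  qed
  have thin_card: "card (Y j) \<le> n - h" if "j \<in> J" for j
  proof -
    have "card (Y j) \<le> card (G - Y i)" using disj[OF that] fin by (intro card_mono) auto
    also have "\<dots> = n - h" using partition2_sides[OF P i(1)] fin
      by (simp add: card_Diff_subset finite_subset n_def h_def)
    finally show ?thesis .
  qed
  have cardJ: "card J + 1 = card I" using i fin card_Suc_Diff1[of I i] by (simp add: J_def)
  then have "J \<noteq> {}" using small by (auto simp: small_case_def)
  then obtain j where j: "j \<in> J" by blast
  have h: "1 \<le> h" "h < n"
  proof -
    show "1 \<le> h" using partition2_sides[OF P i(1)] fin finite_subset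
      by (auto simp: h_def Suc_le_eq card_gt_0_iff)
    show "h < n" using thin_card[OF j] pos[OF j] by linarith
  qed
  have "(\<Sum>j\<in>I. card (X j) * card (Y j)) = n * h + A"
    using i fin by (simp add: sum.remove[of I i] J_def A_def n_def h_def)
  then have A: "A + n * h = n * n" using partition2_area[OF P] by (simp add: n_def)
  have "(\<Sum>j\<in>I. card (X j) + card (Y j)) = n + h + S"
    using i fin by (simp add: sum.remove[of I i] J_def S_def n_def h_def)
  then have S: "n + h + S < 3 * n + c" using less by (simp add: n_def)
  from small consider (four) "card I = 4" "c = 4" "n = 4 \<or> n = 5"
    | (five) "card I = 5" "c = 6" "4 \<le> n" "n \<le> 9"
    unfolding small_case_def n_def by blast
  then show False
  proof cases
    case four
    then have cJ: "card J = 3" using cardJ by simp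
    obtain t where "S = 5 + t" "4 * A \<le> 13 + t\<^sup>2"
      using area_le_convex_3[OF cJ] unfolding S_def A_def by blast
    moreover have "6 \<le> A" using area_sum_3[OF cJ] by (simp add: A_def)
    ultimately show False using no_small_remainder_3[OF four(3) h _ A, of t] S four by simp
  next
    case five
    then have cJ: "card J = 4" using cardJ by simp
    obtain t where t: "S = 9 + t" "4 \<le> t" "4 * A \<le> 29 + t\<^sup>2"
      using area_le_convex_4[OF cJ] unfolding S_def A_def by blast
    have "10 \<le> A" using area_sum_4[OF cJ] by (simp add: A_def)
    moreover have "A \<le> 2 * t + 3" if "n \<le> h + 2"
    proof -
      have "card (Y j) \<le> 2" if "j \<in> J" for j
        using thin_card[OF that] \<open>n \<le> h + 2\<close> by linarith
      then have "A + 4 * card J \<le> 2 * S + 1" unfolding A_def S_def using fin by (intro area_le_thin) auto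
      then show ?thesis using t cJ by simp
    qed
    ultimately show False using no_small_remainder_4[OF five(3,4) h _ t(2) A _ t(3)] S t(1) five by simp
  qed
qed

text \<open>
  The bound in the plane. A dissection without a spanning rectangle has wall length at least
  \<open>2 n\<close>; this is only insufficient for five rectangles and \<open>n \<in> {4, 5}\<close>, where five distinct
  shapes of total area \<open>n\<^sup>2\<close> have too large a semiperimeter already.
\<close>

lemma partition2_perimeter_lower:
  assumes P: "partition2 G I X Y" and inj: "inj_on (\<lambda>i. {#card (X i), card (Y i)#}) I"
    and small: "small_case (card G) (card I) c"
  shows "3 * card G + c \<le> (\<Sum>i\<in>I. card (X i) + card (Y i))"
proof -
  consider (X) i where "i \<in> I" "X i = G" | (Y) i where "i \<in> I" "Y i = G"
    | (none) "\<forall>i\<in>I. X i \<noteq> G" "\<forall>i\<in>I. Y i \<noteq> G" by blast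
  then show ?thesis
  proof cases
    case X
    then show ?thesis by (rule partition2_perimeter_spanning[OF P inj small])
  next
    case Y
    have "inj_on (\<lambda>i. {#card (Y i), card (X i)#}) I" using inj by (simp add: add_mset_commute)
    from partition2_perimeter_spanning[OF partition2_swap[OF P] this small Y]
    show ?thesis by (simp add: add.commute)
  next
    case none
    define A S n where "A = (\<Sum>j\<in>I. card (X j) * card (Y j))"
      and "S = (\<Sum>j\<in>I. card (X j) + card (Y j))" and "n = card G"
    have S: "4 * n \<le> S"
      using partition2_sum_ge_double[OF P none(1)]
        partition2_sum_ge_double[OF partition2_swap[OF P] none(2)]
      by (simp add: S_def n_def sum.distrib)
    show ?thesis
    proof (cases "card I = 5 \<and> n < 6")
      case True
      interpret distinct_pairs I "\<lambda>i. card (X i)" "\<lambda>i. card (Y i)"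
        by (rule partition2_distinct_pairs[OF P inj]) simp
      obtain t where t: "S = 13 + t" "4 * A \<le> 45 + t\<^sup>2"
        using area_le_convex_5 True unfolding S_def A_def by blast
      have A: "A = n * n" using partition2_area[OF P] by (simp add: A_def n_def)
      have n: "n = 4 \<or> n = 5" "c = 6" using small True unfolding small_case_def n_def by auto
      have "3 * n + 6 \<le> S"
      proof (rule ccontr)
        assume "\<not> ?thesis"
        then have "t \<le> 3 * n - 8" using t by simp
        then have "t\<^sup>2 \<le> (3 * n - 8)\<^sup>2" by (intro power_mono) auto
        then have "4 * (n * n) \<le> 45 + (3 * n - 8)\<^sup>2" using t A by linarith
        then show False using n by (elim disjE) simp_all
      qed
      then show ?thesis using n by (simp add: S_def n_def)
    next
      case False
      then have "c \<le> n" using small unfolding small_case_def n_def by auto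
      with S have "3 * n + c \<le> S" by linarith
      then show ?thesis by (simp add: S_def n_def)
    qed
  qed
qed

section \<open>The surface bound in space\<close>

text \<open>
  The analogue of \<^const>\<open>partition2\<close> for the grid \<open>G \<times> G \<times> G\<close>.
\<close>

definition partition3 ::
  "'g set \<Rightarrow> 'i set \<Rightarrow> ('i \<Rightarrow> 'g set) \<Rightarrow> ('i \<Rightarrow> 'g set) \<Rightarrow> ('i \<Rightarrow> 'g set) \<Rightarrow> bool" where
  "partition3 G I X Y Z \<longleftrightarrow> finite G \<and> finite I \<and>
     (\<forall>i\<in>I. X i \<subseteq> G \<and> Y i \<subseteq> G \<and> Z i \<subseteq> G \<and> X i \<noteq> {} \<and> Y i \<noteq> {} \<and> Z i \<noteq> {}) \<and>
     (\<forall>x\<in>G. \<forall>y\<in>G. \<forall>z\<in>G. \<exists>!i. i \<in> I \<and> x \<in> X i \<and> y \<in> Y i \<and> z \<in> Z i)"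

lemma partition3_sides:
  assumes "partition3 G I X Y Z" "i \<in> I"
  shows "X i \<subseteq> G" "Y i \<subseteq> G" "Z i \<subseteq> G" "X i \<noteq> {}" "Y i \<noteq> {}" "Z i \<noteq> {}"
  using assms by (simp_all add: partition3_def)

lemma partition3_finite:
  assumes "partition3 G I X Y Z" shows "finite G" "finite I"
  using assms by (simp_all add: partition3_def)

lemma partition3_rotate:
  assumes P: "partition3 G I X Y Z" shows "partition3 G I Y Z X"
proof -
  have "\<exists>!i. i \<in> I \<and> x \<in> Y i \<and> y \<in> Z i \<and> z \<in> X i" if "x \<in> G" "y \<in> G" "z \<in> G" for x y z
  proof -
    have "\<exists>!i. i \<in> I \<and> z \<in> X i \<and> x \<in> Y i \<and> y \<in> Z i" using P that unfolding partition3_def by blast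
    then show ?thesis by blast
  qed
  then show ?thesis using P by (simp add: partition3_def)
qed

lemma partition3_cell_unique:
  assumes P: "partition3 G I X Y Z" and ij: "i \<in> I" "j \<in> I"
    and "x \<in> X i" "x \<in> X j" "y \<in> Y i" "y \<in> Y j" "z \<in> Z i" "z \<in> Z j"
  shows "i = j"
proof -
  have "x \<in> G" "y \<in> G" "z \<in> G" using assms partition3_sides[OF P ij(1)] by auto
  then have "\<exists>!i. i \<in> I \<and> x \<in> X i \<and> y \<in> Y i \<and> z \<in> Z i" using P unfolding partition3_def by blast
  then show ?thesis using assms by blast
qed

lemma partition3_slice:
  assumes P: "partition3 G I X Y Z" and z: "z \<in> G"
  shows "partition2 G {i\<in>I. z \<in> Z i} X Y"
proof -
  have "\<exists>!i. i \<in> {i\<in>I. z \<in> Z i} \<and> x \<in> X i \<and> y \<in> Y i" if "x \<in> G" "y \<in> G" for x y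
  proof -
    have "\<exists>!i. i \<in> I \<and> x \<in> X i \<and> y \<in> Y i \<and> z \<in> Z i" using P that z unfolding partition3_def by blast
    then show ?thesis by blast
  qed
  then show ?thesis using P by (simp add: partition2_def partition3_def)
qed

lemma partition3_sum_slices:
  fixes f :: "'i \<Rightarrow> nat"
  assumes P: "partition3 G I X Y Z"
  shows "(\<Sum>i\<in>I. card (Z i) * f i) = (\<Sum>z\<in>G. \<Sum>i\<in>{i\<in>I. z \<in> Z i}. f i)"
proof -
  note fin = partition3_finite[OF P]
  have "(\<Sum>i\<in>I. card (Z i) * f i) = (\<Sum>i\<in>I. \<Sum>z\<in>G. if z \<in> Z i then f i else 0)"
  proof (rule sum.cong)
    fix i assume "i \<in> I"
    then have "G \<inter> {z. z \<in> Z i} = Z i" using partition3_sides[OF P] by blast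
    then show "card (Z i) * f i = (\<Sum>z\<in>G. if z \<in> Z i then f i else 0)"
      using fin by (simp add: sum.If_cases)
  qed simp
  also have "\<dots> = (\<Sum>z\<in>G. \<Sum>i\<in>I. if z \<in> Z i then f i else 0)" by (rule sum.swap)
  also have "\<dots> = (\<Sum>z\<in>G. \<Sum>i\<in>{i\<in>I. z \<in> Z i}. f i)"
    using fin by (simp add: sum.inter_filter)
  finally show ?thesis .
qed

lemma partition3_full:
  assumes P: "partition3 G I X Y Z" and a: "a \<in> I" "X a = G" "Z a = G" and b: "b \<in> I" "Y b = G"
  shows "I = {a}"
proof -
  obtain x y z where xyz: "x \<in> X b" "y \<in> Y a" "z \<in> Z b"
    using partition3_sides[OF P a(1)] partition3_sides[OF P b(1)] by auto
  then have "x \<in> G" "y \<in> G" "z \<in> G"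
    using partition3_sides[OF P a(1)] partition3_sides[OF P b(1)] by auto
  then have "a = b"
    using partition3_cell_unique[OF P a(1) b(1), of x y z] xyz a b by simp
  have "k = a" if k: "k \<in> I" for k
  proof -
    obtain x' y' z' where "x' \<in> X k" "y' \<in> Y k" "z' \<in> Z k" using partition3_sides[OF P k] by auto
    then show ?thesis
      using partition3_cell_unique[OF P k a(1), of x' y' z'] partition3_sides[OF P k] a b \<open>a = b\<close>
      by auto
  qed
  then show ?thesis using a(1) by blast
qed

lemma partition2_singleton:
  assumes P: "partition2 G {i} X Y" and "x \<in> G"
  shows "X i = G" "Y i = G"
proof -
  have "G \<subseteq> X i" "G \<subseteq> Y i"
    using partition2_cell_covered[OF P] \<open>x \<in> G\<close> by (metis singletonD subsetI)+
  then show "X i = G" "Y i = G" using partition2_sides[OF P, of i] by auto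
qed

lemma partition2_card_ge_2:
  assumes P: "partition2 G I X Y" and x: "x \<in> G" and none: "\<And>i. i \<in> I \<Longrightarrow> \<not> (X i = G \<and> Y i = G)"
  shows "2 \<le> card I"
proof (rule ccontr)
  assume "\<not> ?thesis"
  moreover have "finite I" using P by (simp add: partition2_def)
  moreover have "I \<noteq> {}" using partition2_cell_covered[OF P x x] by blast
  ultimately have "card I = 1" using card_gt_0_iff[of I] by linarith
  then obtain i where "I = {i}" by (auto simp: card_1_singleton_iff)
  with partition2_singleton[of G i X Y x] P x none show False by simp
qed

text \<open>
  Suppose that each direction has a box spanning it. The box \<open>c\<close> that spans the third direction
  meets every slice orthogonal to that direction and is not a full layer, so every slice is a
  nontrivial dissection; a slice through the box \<open>a\<close> has at least three pieces.
\<close>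

lemma partition3_all_spanning_slices:
  assumes P: "partition3 G I X Y Z" and I: "2 \<le> card I"
    and a: "a \<in> I" "X a = G" and b: "b \<in> I" "Y b = G" and c: "c \<in> I" "Z c = G"
  shows "3 * card G * card G + 1 \<le> (\<Sum>i\<in>I. card (Z i) * (card (X i) + card (Y i)))"
proof -
  let ?T = "\<lambda>z. {i\<in>I. z \<in> Z i}" and ?s = "\<lambda>z. \<Sum>i\<in>{i\<in>I. z \<in> Z i}. card (X i) + card (Y i)"
  note fin = partition3_finite[OF P]
  have I1: "I \<noteq> {i}" for i using I by auto
  have cX: "X c \<noteq> G" using partition3_full[OF P c(1) _ c(2) b] I1 by blast
  have slice2: "3 * card G \<le> ?s z" if z: "z \<in> G" for z
  proof (rule partition2_perimeter_2[OF partition3_slice[OF P z]], rule partition2_card_ge_2[OF partition3_slice[OF P z] z])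
    fix i assume i: "i \<in> ?T z"
    show "\<not> (X i = G \<and> Y i = G)"
    proof
      assume full: "X i = G \<and> Y i = G"
      obtain x y where "x \<in> X c" "y \<in> Y c" using partition3_sides[OF P c(1)] by auto
      then have "i = c"
        using partition3_cell_unique[OF P _ c(1), of i x y z] partition3_sides[OF P c(1)] i full c z
        by auto
      with full cX show False by simp
    qed
  qed
  obtain z where z: "z \<in> Z a" "z \<in> G" using partition3_sides[OF P a(1)] by blast
  have ac: "a \<noteq> c" using cX a by auto
  obtain x y where xy: "x \<in> X c" "y \<in> Y c" "x \<in> G" "y \<in> G"
    using partition3_sides[OF P c(1)] by blast
  have "y \<notin> Y a"
    using partition3_cell_unique[OF P a(1) c(1), of x y z] xy z a c ac by auto
  obtain x' where x': "x' \<in> G" "x' \<notin> X c" using cX partition3_sides[OF P c(1)] by blast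
  \<comment> \<open>a third piece of the slice: in the row \<open>y\<close>, which misses \<open>a\<close>, to the side of \<open>c\<close>\<close>
  obtain d where d: "d \<in> ?T z" "x' \<in> X d" "y \<in> Y d"
    by (rule partition2_cell_covered[OF partition3_slice[OF P z(2)] x'(1) xy(4)])
  have "d \<noteq> a" "d \<noteq> c" using d x' \<open>y \<notin> Y a\<close> by auto
  then have "3 \<le> card (?T z)"
    using d a c z ac fin by (intro card_ge_3I[of _ a c d]) auto
  then have slice3: "3 * card G + 1 \<le> ?s z"
    by (rule partition2_perimeter_3[OF partition3_slice[OF P z(2)]])
  have "(\<Sum>z\<in>G. 3 * card G) < (\<Sum>z\<in>G. ?s z)"
  proof (rule sum_strict_mono_ex1[OF fin(1)])
    show "\<forall>z\<in>G. 3 * card G \<le> ?s z" using slice2 by blast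
    show "\<exists>z\<in>G. 3 * card G < ?s z" using slice3 z(2) by (intro bexI[of _ z]) auto
  qed
  then show ?thesis
    unfolding partition3_sum_slices[OF P] by (simp add: ac_simps)
qed

text \<open>
  Half the surface area of a box. The sum over a dissection is the interface plus \<open>3 (card G)\<^sup>2\<close>.
\<close>

abbreviation surface :: "('i \<Rightarrow> 'g set) \<Rightarrow> ('i \<Rightarrow> 'g set) \<Rightarrow> ('i \<Rightarrow> 'g set) \<Rightarrow> 'i \<Rightarrow> nat" where
  "surface X Y Z i \<equiv> card (X i) * card (Y i) + card (Y i) * card (Z i) + card (Z i) * card (X i)"

lemma partition3_surface_all_spanning:
  assumes P: "partition3 G I X Y Z" and I: "2 \<le> card I" and n: "4 \<le> card G" "c \<le> 6"
    and a: "a \<in> I" "X a = G" and b: "b \<in> I" "Y b = G" and d: "d \<in> I" "Z d = G"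
  shows "4 * (card G)\<^sup>2 + card G + c \<le> (\<Sum>i\<in>I. surface X Y Z i)"
proof -
  define n where "n = card G"
  have "3 * n * n + 1 \<le> (\<Sum>i\<in>I. card (Z i) * (card (X i) + card (Y i)))"
    "3 * n * n + 1 \<le> (\<Sum>i\<in>I. card (X i) * (card (Y i) + card (Z i)))"
    "3 * n * n + 1 \<le> (\<Sum>i\<in>I. card (Y i) * (card (Z i) + card (X i)))"
    using partition3_all_spanning_slices[OF P I a b d]
      partition3_all_spanning_slices[OF partition3_rotate[OF P] I b d a]
      partition3_all_spanning_slices[OF partition3_rotate[OF partition3_rotate[OF P]] I d a b]
    by (simp_all add: n_def)
  then have "3 * n\<^sup>2 + 1 + (3 * n\<^sup>2 + 1) + (3 * n\<^sup>2 + 1) \<le>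
      (\<Sum>i\<in>I. card (Z i) * (card (X i) + card (Y i)) + card (X i) * (card (Y i) + card (Z i))
        + card (Y i) * (card (Z i) + card (X i)))"
    unfolding sum.distrib power2_eq_square by (simp add: mult.assoc)
  also have "\<dots> = (\<Sum>i\<in>I. 2 * surface X Y Z i)"
    by (intro sum.cong) (simp_all add: algebra_simps)
  finally have "9 * n\<^sup>2 + 3 \<le> 2 * (\<Sum>i\<in>I. surface X Y Z i)"
    unfolding sum_distrib_left[symmetric] by linarith
  moreover have "4 * n \<le> n\<^sup>2" using n by (simp add: power2_eq_square n_def)
  ultimately show ?thesis using n unfolding n_def[symmetric] by linarith
qed

text \<open>
  Every line in the third direction meets at least two boxes.
\<close>

lemma partition3_projection_area:
  assumes P: "partition3 G I X Y Z" and cut: "\<And>i. i \<in> I \<Longrightarrow> Z i \<noteq> G"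
  shows "2 * (card G)\<^sup>2 \<le> (\<Sum>i\<in>I. card (X i) * card (Y i))"
proof -
  note fin = partition3_finite[OF P]
  have "(\<Sum>w\<in>G \<times> G. 2) \<le> (\<Sum>w\<in>G \<times> G. card {i\<in>I. w \<in> X i \<times> Y i})"
  proof (rule sum_mono)
    fix w assume "w \<in> G \<times> G"
    then obtain x y where w: "w = (x, y)" "x \<in> G" "y \<in> G" by blast
    obtain i where i: "i \<in> I" "x \<in> X i" "y \<in> Y i"
      by (rule partition2_cell_covered[OF partition3_slice[OF P w(2)] w(2,3)]) blast
    obtain z where z: "z \<in> G" "z \<notin> Z i" using cut[OF i(1)] partition3_sides[OF P i(1)] by blast
    obtain j where j: "j \<in> {i\<in>I. z \<in> Z i}" "x \<in> X j" "y \<in> Y j"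
      by (rule partition2_cell_covered[OF partition3_slice[OF P z(1)] w(2,3)])
    have "j \<noteq> i" using z j by auto
    then show "2 \<le> card {i\<in>I. w \<in> X i \<times> Y i}"
      using i j w fin by (intro card_ge_2I[of _ i j]) auto
  qed
  also have "\<dots> = (\<Sum>i\<in>I. card (X i \<times> Y i))"
    using fin partition3_sides[OF P] by (intro sum_card_double_count[symmetric]) auto
  finally show ?thesis by (simp add: card_cartesian_product power2_eq_square)
qed

text \<open>
  The slices outside the unique full slab \<open>a\<close> are nontrivial dissections. If there are at least two
  of them, their wall lengths and the \<open>n\<^sup>2\<close> cuts of the lines orthogonal to the slices suffice, except
  possibly for six boxes and exactly two such slices of which one has only two pieces. In that
  case at least three boxes other than \<open>a\<close> avoid that slice, so they lie in the other slice only
  and add at least 3 to the area of the facets between the layers.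
\<close>

lemma partition3_surface_two_layers:
  assumes P: "partition3 G I X Y Z" and n: "4 \<le> card G"
    and c: "card I = 5 \<and> c = 4 \<or> card I = 6 \<and> c = 6"
    and a: "a \<in> I" "X a = G" "Y a = G"
    and slab: "\<And>i. i \<in> I \<Longrightarrow> X i = G \<Longrightarrow> Y i = G \<Longrightarrow> i = a"
    and cut: "\<And>i. i \<in> I \<Longrightarrow> Z i \<noteq> G" and two: "2 \<le> card (G - Z a)"
  shows "4 * (card G)\<^sup>2 + card G + c \<le> (\<Sum>i\<in>I. card (X i) * card (Y i)) +
      (\<Sum>i\<in>I. card (Z i) * (card (X i) + card (Y i)))"
proof -
  let ?T = "\<lambda>z. {i\<in>I. z \<in> Z i}"
  define n N where "n = card G" and "N = G - Z a"
  define s where "s z = (\<Sum>i\<in>?T z. card (X i) + card (Y i))" for z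
  define A where "A = (\<Sum>i\<in>I. card (X i) * card (Y i))"
  define Q where "Q = (\<Sum>i\<in>I. card (Z i) * (card (X i) + card (Y i)))"
  note fin = partition3_finite[OF P]
  note sides = partition3_sides[OF P]
  note slice = partition3_slice[OF P]
  have finN: "finite N" "finite (Z a)" 
    using finite_subset[OF sides(3)[OF a(1)] fin(1)] fin by (simp_all add: N_def)
  have n4: "4 \<le> n" using n by (simp add: n_def)
  have A: "2 * n\<^sup>2 \<le> A" unfolding A_def n_def by (rule partition3_projection_area[OF P cut])
  have semi_ge_2: "2 * n \<le> s z" if "z \<in> G" for z
    using partition2_sum_ge[OF slice[OF that]] partition2_sum_ge[OF partition2_swap[OF slice[OF that]]]
    by (simp add: s_def n_def sum.distrib)
  have s_ge_3: "3 * n \<le> s z" if z: "z \<in> N" for z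
  proof -
    have zG: "z \<in> G" using z by (simp add: N_def)
    have "\<not> (X i = G \<and> Y i = G)" if "i \<in> ?T z" for i
      using slab[of i] that z by (auto simp: N_def)
    then show ?thesis unfolding s_def n_def
      by (rule partition2_perimeter_2[OF slice[OF zG] partition2_card_ge_2[OF slice[OF zG] zG]])
  qed
  have s_ge_4: "3 * n + 1 \<le> s z" if "z \<in> N" "3 \<le> card (?T z)" for z
    using partition2_perimeter_3[OF slice that(2)] that(1) by (simp add: s_def n_def N_def)
  have G: "G = Z a \<union> N" "Z a \<inter> N = {}" using sides[OF a(1)] by (auto simp: N_def)
  have "Q = (\<Sum>z\<in>Z a \<union> N. s z)"
    unfolding Q_def s_def G(1)[symmetric] by (rule partition3_sum_slices[OF P])
  also have "\<dots> = (\<Sum>z\<in>Z a. s z) + (\<Sum>z\<in>N. s z)" using G(2) finN by (intro sum.union_disjoint)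
  finally have Q: "Q = (\<Sum>z\<in>Z a. s z) + (\<Sum>z\<in>N. s z)" .
  have "(\<Sum>z\<in>Z a. 2 * n) \<le> (\<Sum>z\<in>Z a. s z)"
    using semi_ge_2 sides[OF a(1)] by (intro sum_mono) auto
  moreover have "n = card (Z a) + card N"
    unfolding n_def by (subst G(1), rule card_Un_disjoint[OF finN(2,1) G(2)])
  then have "(\<Sum>z\<in>Z a. 2 * n) + 2 * n * card N = 2 * n\<^sup>2"
    by (simp add: power2_eq_square algebra_simps flip: distrib_left)
  ultimately have Q_ge: "2 * n\<^sup>2 + (\<Sum>z\<in>N. s z) \<le> Q + 2 * n * card N" using Q by linarith
  have "4 * n\<^sup>2 + n + c \<le> A + Q"
  proof (cases "c = 4 \<or> 3 \<le> card N")
    case True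
    have "(\<Sum>z\<in>N. 3 * n) \<le> (\<Sum>z\<in>N. s z)" using s_ge_3 by (intro sum_mono) auto
    then have "2 * n\<^sup>2 + n * card N \<le> Q" using Q_ge by (simp add: algebra_simps)
    moreover have "n + c \<le> n * card N"
    proof (cases "3 \<le> card N")
      case True
      then have "n * 3 \<le> n * card N" by (intro mult_le_mono2)
      then show ?thesis using c n4 by linarith
    next
      case False
      then have "c = 4" using \<open>c = 4 \<or> 3 \<le> card N\<close> by simp
      have "n * 2 \<le> n * card N" using two by (intro mult_le_mono2) (simp add: N_def)
      then show ?thesis using \<open>c = 4\<close> n4 by linarith
    qed
    ultimately show ?thesis using A by linarith
  next
    case False
    then have c6: "card I = 6" "c = 6" and "card N = 2" using c two by (auto simp: N_def)
    then obtain z w where N: "N = {z, w}" "z \<noteq> w" by (auto simp: card_2_iff)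
    \<comment> \<open>for a slice \<open>u\<close> with at most two pieces and the other slice \<open>v\<close>\<close>
    have few: "3 * n + 1 \<le> s v \<and> 2 * n\<^sup>2 + 3 \<le> A"
      if N: "N = {u, v}" "u \<noteq> v" and le: "card (?T u) \<le> 2" for u v
    proof
      define B where "B = I - {a} - ?T u"
      have u: "u \<in> G" "a \<notin> ?T u" using N by (auto simp: N_def)
      have "card (I - {a}) = 5" using c6 a(1) fin by simp
      moreover have "card (I - {a}) - card (?T u) \<le> card B"
        unfolding B_def by (rule diff_card_le_card_Diff) (use fin in auto)
      ultimately have B3: "3 \<le> card B" using le by linarith
      have finB: "finite B" "B \<subseteq> I" using fin by (auto simp: B_def)
      have "B \<subseteq> ?T v"
      proof
        fix i assume i: "i \<in> B"
        then have i': "i \<in> I" "i \<noteq> a" "u \<notin> Z i" by (auto simp: B_def)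
        obtain x y z where xyz: "x \<in> X i" "y \<in> Y i" "z \<in> Z i" using sides[OF i'(1)] by auto
        then have xyzG: "x \<in> G" "y \<in> G" "z \<in> G" using sides[OF i'(1)] by auto
        then have "z \<notin> Z a" using partition3_cell_unique[OF P i'(1) a(1), of x y z] xyz i' a by auto
        then have "z \<in> {u, v}" using xyzG N by (auto simp: N_def)
        then show "i \<in> ?T v" using xyz i' by auto
      qed
      then have "card B \<le> card (?T v)" using fin by (intro card_mono) auto
      then have "3 \<le> card (?T v)" using B3 by linarith
      then show "3 * n + 1 \<le> s v" using s_ge_4 N by blast
      have "card B \<le> (\<Sum>i\<in>B. card (X i) * card (Y i))"
      proof -
        have "1 \<le> card (X i) * card (Y i)" if "i \<in> B" for i
        proof -
          have "finite (X i)" "finite (Y i)" "X i \<noteq> {}" "Y i \<noteq> {}"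
            using sides[of i] that finB fin finite_subset by blast+
          then show ?thesis by (simp add: Suc_le_eq card_gt_0_iff)
        qed
        then have "(\<Sum>i\<in>B. 1) \<le> (\<Sum>i\<in>B. card (X i) * card (Y i))" by (intro sum_mono)
        then show ?thesis by simp
      qed
      moreover have "A = n\<^sup>2 + (\<Sum>i\<in>?T u. card (X i) * card (Y i)) + (\<Sum>i\<in>B. card (X i) * card (Y i))"
      proof -
        have "A = (\<Sum>i\<in>insert a (?T u \<union> B). card (X i) * card (Y i))"
          unfolding A_def using a(1) by (intro sum.cong) (auto simp: B_def)
        also have "\<dots> = n * n + (\<Sum>i\<in>?T u \<union> B. card (X i) * card (Y i))"
          using u fin finB a by (subst sum.insert) (auto simp: B_def n_def)
        also have "(\<Sum>i\<in>?T u \<union> B. card (X i) * card (Y i)) =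
            (\<Sum>i\<in>?T u. card (X i) * card (Y i)) + (\<Sum>i\<in>B. card (X i) * card (Y i))"
          using fin finB by (intro sum.union_disjoint) (auto simp: B_def)
        finally show ?thesis by (simp add: power2_eq_square)
      qed
      ultimately show "2 * n\<^sup>2 + 3 \<le> A"
        using B3 partition2_area[OF slice[OF u(1)]] by (simp add: n_def power2_eq_square)
    qed
    have Q2: "2 * n\<^sup>2 + s z + s w \<le> Q + 4 * n" using Q_ge N by simp
    have s3: "3 * n \<le> s z" "3 * n \<le> s w" using s_ge_3 N by auto
    show ?thesis
    proof (cases "card (?T z) \<le> 2 \<or> card (?T w) \<le> 2")
      case True
      have "N = {w, z}" using N by auto
      then have "2 * n\<^sup>2 + 3 \<le> A" "6 * n + 1 \<le> s z + s w"
        using True few[of z w] few[of w z] N s3 by auto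
      then show ?thesis using Q2 n4 c6 by linarith
    next
      case False
      then have "3 * n + 1 \<le> s z" "3 * n + 1 \<le> s w" using s_ge_4 N by auto
      then show ?thesis using Q2 n4 c6 A by linarith
    qed
  qed
  then show ?thesis by (simp add: n_def A_def Q_def)
qed

text \<open>
  If no box spans the third direction, then every line in this direction is cut, which costs
  \<open>n\<^sup>2\<close>. Too large an interface is avoided only by a single full slab and a single further
  layer, and the remaining boxes are then a dissection of that layer into \<open>m\<close> rectangles of
  distinct shapes.
\<close>

lemma partition3_surface_cut:
  assumes P: "partition3 G I X Y Z" and n: "4 \<le> card G"
    and inj: "inj_on (\<lambda>i. {#card (X i), card (Y i), card (Z i)#}) I"
    and m: "card I = Suc m" and small: "small_case (card G) m c"
    and cut: "\<And>i. i \<in> I \<Longrightarrow> Z i \<noteq> G"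
  shows "4 * (card G)\<^sup>2 + card G + c \<le> (\<Sum>i\<in>I. surface X Y Z i)"
proof -
  let ?T = "\<lambda>z. {i\<in>I. z \<in> Z i}"
  define n where "n = card G"
  define s where "s z = (\<Sum>i\<in>?T z. card (X i) + card (Y i))" for z
  define A where "A = (\<Sum>i\<in>I. card (X i) * card (Y i))"
  define Q where "Q = (\<Sum>i\<in>I. card (Z i) * (card (X i) + card (Y i)))"
  note fin = partition3_finite[OF P]
  note sides = partition3_sides[OF P]
  note slice = partition3_slice[OF P]
  have surf: "(\<Sum>i\<in>I. surface X Y Z i) = A + Q"
    unfolding A_def Q_def sum.distrib[symmetric] by (intro sum.cong) (simp_all add: algebra_simps)
  have Q: "Q = (\<Sum>z\<in>G. s z)" unfolding Q_def s_def by (rule partition3_sum_slices[OF P])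
  have A: "2 * n\<^sup>2 \<le> A" unfolding A_def n_def by (rule partition3_projection_area[OF P cut])
  have m': "4 \<le> m" "c \<le> 6" using small by (auto simp: small_case_def)
  have nc: "n + c \<le> n\<^sup>2"
  proof -
    have "4 * n \<le> n * n" using n by (simp add: n_def)
    then show ?thesis using n m' unfolding power2_eq_square n_def[symmetric] by linarith
  qed
  have semi_ge_2: "2 * n \<le> s z" if "z \<in> G" for z
    using partition2_sum_ge[OF slice[OF that]] partition2_sum_ge[OF partition2_swap[OF slice[OF that]]]
    by (simp add: s_def n_def sum.distrib)
  have s_ge_3: "3 * n \<le> s z" if "z \<in> G" "\<And>i. i \<in> ?T z \<Longrightarrow> \<not> (X i = G \<and> Y i = G)" for z
    unfolding s_def n_def
    by (rule partition2_perimeter_2[OF slice[OF that(1)] partition2_card_ge_2[OF slice[OF that(1)] that]])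
  consider (none) "\<And>i. i \<in> I \<Longrightarrow> \<not> (X i = G \<and> Y i = G)"
    | (two) a b where "a \<in> I" "X a = G" "Y a = G" "b \<in> I" "X b = G" "Y b = G" "a \<noteq> b"
    | (one) a where "a \<in> I" "X a = G" "Y a = G" "\<And>i. i \<in> I \<Longrightarrow> X i = G \<Longrightarrow> Y i = G \<Longrightarrow> i = a"
    by blast
  then show ?thesis
  proof cases
    case none
    have "(\<Sum>z\<in>G. 3 * n) \<le> Q" unfolding Q using s_ge_3 none by (intro sum_mono) auto
    then have "3 * n\<^sup>2 \<le> Q" by (simp add: n_def power2_eq_square ac_simps)
    then show ?thesis using A nc unfolding surf n_def[symmetric] by linarith
  next
    case two
    have "(\<Sum>z\<in>G. 2 * n) \<le> Q" unfolding Q using semi_ge_2 by (intro sum_mono) auto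
    then have "2 * n\<^sup>2 \<le> Q" by (simp add: n_def power2_eq_square ac_simps)
    moreover have "3 * n\<^sup>2 \<le> A"
    proof -
      have "card (I - {a, b}) > 0" using two m m' fin by (subst card_Diff_subset) auto
      then obtain d where d: "d \<in> I" "d \<noteq> a" "d \<noteq> b" by (metis DiffE card_gt_0_iff ex_in_conv insertCI)
      obtain x y z where xyz: "x \<in> X d" "y \<in> Y d" "z \<in> Z d" using sides[OF d(1)] by auto
      then have xyzG: "x \<in> G" "y \<in> G" "z \<in> G" using sides[OF d(1)] by auto
      have "z \<notin> Z a" "z \<notin> Z b"
        using partition3_cell_unique[OF P d(1), of a x y z] partition3_cell_unique[OF P d(1), of b x y z]
          xyz xyzG two d by auto
      then have sub: "?T z \<union> {a, b} \<subseteq> I" "a \<notin> ?T z" "b \<notin> ?T z" using two by auto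
      have "(\<Sum>i\<in>?T z \<union> {a, b}. card (X i) * card (Y i)) \<le> A"
        unfolding A_def using sub fin by (intro sum_mono2) auto
      moreover have "(\<Sum>i\<in>?T z \<union> {a, b}. card (X i) * card (Y i)) =
          (\<Sum>i\<in>?T z. card (X i) * card (Y i)) + (n * n + n * n)"
        using sub fin two by (subst sum.union_disjoint) (auto simp: n_def)
      ultimately show ?thesis
        using partition2_area[OF slice[OF xyzG(3)]] by (simp add: n_def power2_eq_square)
    qed
    ultimately show ?thesis using nc unfolding surf n_def[symmetric] by linarith
  next
    case one
    have "G - Z a \<noteq> {}" using cut[OF one(1)] sides[OF one(1)] by auto
    show ?thesis
    proof (cases "2 \<le> card (G - Z a)")
      case True
      have "card I = 5 \<and> c = 4 \<or> card I = 6 \<and> c = 6" using m small by (auto simp: small_case_def)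
      then show ?thesis
        using partition3_surface_two_layers[OF P n _ one cut True] unfolding surf A_def Q_def by blast
    next
      case False
      moreover have "0 < card (G - Z a)" using \<open>G - Z a \<noteq> {}\<close> fin by (simp add: card_gt_0_iff)
      ultimately have "card (G - Z a) = 1" by linarith
      then obtain z where z: "G - Z a = {z}" by (auto simp: card_1_singleton_iff)
      then have zG: "z \<in> G" "z \<notin> Z a" by auto
      have Z: "Z i = {z}" if i: "i \<in> I" "i \<noteq> a" for i
      proof -
        obtain x y where xy: "x \<in> X i" "y \<in> Y i" using sides[OF i(1)] by auto
        then have "x \<in> G" "y \<in> G" using sides[OF i(1)] by auto
        then have "w \<notin> Z a" if "w \<in> Z i" for w
          using partition3_cell_unique[OF P i(1) one(1) xy(1) _ xy(2) _ that] one(1-3) i by auto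
        then have "Z i \<subseteq> {z}" using z sides[OF i(1)] by blast
        then show ?thesis using sides[OF i(1)] by auto
      qed
      have T: "?T z = I - {a}" using Z zG by auto
      note sl = slice[OF zG(1), unfolded T]
      have "inj_on (\<lambda>i. {#card (X i), card (Y i)#}) (I - {a})"
      proof (rule inj_onI)
        fix i j assume ij: "i \<in> I - {a}" "j \<in> I - {a}"
          and eq: "{#card (X i), card (Y i)#} = {#card (X j), card (Y j)#}"
        then have "card (Z i) = card (Z j)" using Z by auto
        then have "{#card (X i), card (Y i), card (Z i)#} = {#card (X j), card (Y j), card (Z j)#}"
          using eq by (metis add_mset_commute)
        then show "i = j" using inj ij by (auto dest: inj_onD)
      qed
      moreover have "card (I - {a}) = m" using m one(1) fin by simp
      ultimately have "3 * n + c \<le> s z"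
        using partition2_perimeter_lower[OF sl] small by (simp add: s_def T n_def)
      moreover have "Q = (\<Sum>w\<in>Z a. s w) + s z"
      proof -
        have "G = Z a \<union> {z}" using z sides[OF one(1)] by blast
        then show ?thesis unfolding Q using zG fin by (metis add.commute finite_Un sum.insert Un_insert_right sup_bot_right)
      qed
      moreover have "(\<Sum>w\<in>Z a. 2 * n) \<le> (\<Sum>w\<in>Z a. s w)"
        using semi_ge_2 sides[OF one(1)] by (intro sum_mono) auto
      moreover have "(\<Sum>w\<in>Z a. 2 * n) + 2 * n = 2 * n\<^sup>2"
      proof -
        have "G = insert z (Z a)" using z sides[OF one(1)] by blast
        then have "n = Suc (card (Z a))" using zG fin by (simp add: n_def)
        then show ?thesis by (simp add: power2_eq_square)
      qed
      ultimately show ?thesis using A unfolding surf n_def[symmetric] by linarith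
    qed
  qed
qed

lemma partition3_surface_lower:
  assumes P: "partition3 G I X Y Z"
    and inj: "inj_on (\<lambda>i. {#card (X i), card (Y i), card (Z i)#}) I"
    and m: "card I = Suc m" and small: "small_case (card G) m c"
  shows "4 * (card G)\<^sup>2 + card G + c \<le> (\<Sum>i\<in>I. surface X Y Z i)"
proof -
  have n: "4 \<le> card G" and c: "c \<le> 6" and I: "2 \<le> card I" using small m by (auto simp: small_case_def)
  note P' = partition3_rotate[OF P]
  note P'' = partition3_rotate[OF P']
  have rot: "{#a, b, d#} = {#b, d, a#}" for a b d :: nat by simp
  have inj': "inj_on (\<lambda>i. {#card (Y i), card (Z i), card (X i)#}) I"
    "inj_on (\<lambda>i. {#card (Z i), card (X i), card (Y i)#}) I"
    using inj unfolding rot[of "card (X _)"] rot[of "card (Y _)"] by simp_all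
  consider (Z) "\<And>i. i \<in> I \<Longrightarrow> Z i \<noteq> G" | (X) "\<And>i. i \<in> I \<Longrightarrow> X i \<noteq> G" | (Y) "\<And>i. i \<in> I \<Longrightarrow> Y i \<noteq> G"
    | (full) a b d where "a \<in> I" "X a = G" "b \<in> I" "Y b = G" "d \<in> I" "Z d = G"
    by blast
  then show ?thesis
  proof cases
    case Z
    then show ?thesis using partition3_surface_cut[OF P n inj m small] by blast
  next
    case X
    then show ?thesis using partition3_surface_cut[OF P' n inj'(1) m small] by (simp add: ac_simps)
  next
    case Y
    then show ?thesis using partition3_surface_cut[OF P'' n inj'(2) m small] by (simp add: ac_simps)
  next
    case full
    then show ?thesis by (rule partition3_surface_all_spanning[OF P I n c])
  qed
qed

section \<open>Lattice boxes and the cells of a tiling\<close>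

text \<open>
  The cells covered by a box with integer corners in direction \<open>i\<close>, where the cell \<open>p\<close> is the unit
  cube with least vertex \<open>p\<close>.
\<close>

definition side :: "(real ^ 'd) set \<Rightarrow> 'd \<Rightarrow> int set" where
  "side K i = {\<lfloor>interval_lowerbound K $ i\<rfloor> ..< \<lfloor>interval_upperbound K $ i\<rfloor>}"

text \<open>
  The box with integer corners \<open>a\<close> and \<open>b\<close>.
\<close>

abbreviation lattice_box :: "int ^ 'd \<Rightarrow> int ^ 'd \<Rightarrow> (real ^ 'd) set" where
  "lattice_box a b \<equiv> cbox (\<chi> i. of_int (a $ i)) (\<chi> i. of_int (b $ i))"

lemma lattice_box_iff:
  "x \<in> lattice_box a b \<longleftrightarrow> (\<forall>i. of_int (a $ i) \<le> x $ i \<and> x $ i \<le> of_int (b $ i))"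
  by (simp add: mem_box_cart)

lemma
  assumes "\<And>i. a $ i < b $ i"
  shows interval_lowerbound_lattice_box:
      "interval_lowerbound (lattice_box a b) = (\<chi> i. of_int (a $ i))"
    and interval_upperbound_lattice_box:
      "interval_upperbound (lattice_box a b) = (\<chi> i. of_int (b $ i))"
proof -
  have "lattice_box a b \<noteq> {}" using assms by (simp add: interval_ne_empty_cart less_imp_le)
  then show "interval_lowerbound (lattice_box a b) = (\<chi> i. of_int (a $ i))"
      "interval_upperbound (lattice_box a b) = (\<chi> i. of_int (b $ i))"
    by (simp_all add: interval_lowerbound interval_upperbound box_ne_empty)
qed

lemma side_lattice_box:
  assumes "\<And>i. a $ i < b $ i"
  shows "side (lattice_box a b) k = {a $ k ..< b $ k}"
  using assms
  by (simp add: side_def interval_lowerbound_lattice_box interval_upperbound_lattice_box)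

lemma dims_int_box:
  assumes "int_box K"
  shows "dims K = {# real (card (side K i)). i \<in># mset_set UNIV #}"
proof -
  obtain a b where ab: "\<And>i. a $ i < b $ i" "K = lattice_box a b"
    using assms unfolding int_box_def by blast
  have "real (card (side K i)) = of_int (b $ i) - of_int (a $ i)" for i
    using ab(1)[of i] by (simp add: ab(2) side_lattice_box[OF ab(1)])
  then show ?thesis using ab(1)
    by (simp add: dims_def ab(2) interval_lowerbound_lattice_box interval_upperbound_lattice_box)
qed

lemma interior_lattice_box_iff:
  "x \<in> interior (lattice_box a b) \<longleftrightarrow> (\<forall>i. of_int (a $ i) < x $ i \<and> x $ i < of_int (b $ i))"
  by (simp add: interior_cbox mem_box_cart)

text \<open>
  The centre of the cell \<open>p\<close>; it lies on no boundary of a lattice box.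
\<close>

definition cell_centre :: "int ^ 'd \<Rightarrow> real ^ 'd" where
  "cell_centre p = (\<chi> i. of_int (p $ i) + 1 / 2)"

lemma of_int_le_add_half: "of_int a \<le> (of_int p + 1 / 2 :: real) \<longleftrightarrow> a \<le> p" for a p :: int
  by linarith

lemma add_half_le_of_int: "(of_int p + 1 / 2 :: real) \<le> of_int b \<longleftrightarrow> p < b" for b p :: int
  by linarith

lemma cell_centre_in_box:
  "cell_centre p \<in> lattice_box a b \<longleftrightarrow> (\<forall>i. p $ i \<in> {a $ i ..< b $ i})"
  by (simp add: lattice_box_iff cell_centre_def of_int_le_add_half add_half_le_of_int)

lemma cell_centre_in_interior:
  assumes "\<And>i. p $ i \<in> {a $ i ..< b $ i}"
  shows "cell_centre p \<in> interior (lattice_box a b)"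
  unfolding interior_lattice_box_iff
proof
  fix i
  have "a $ i \<le> p $ i" "p $ i + 1 \<le> b $ i" using assms[of i] by auto
  then have "real_of_int (a $ i) \<le> p $ i" "real_of_int (p $ i) + 1 \<le> b $ i" by linarith+
  then show "of_int (a $ i) < cell_centre p $ i \<and> cell_centre p $ i < of_int (b $ i)"
    by (simp add: cell_centre_def)
qed

lemma tiling_box:
  assumes T: "tiling n T" and K: "K \<in> T"
  obtains a b where "\<And>i. a $ i < b $ i" "K = lattice_box a b" "\<And>i. side K i = {a $ i ..< b $ i}"
    "\<And>i. 0 \<le> a $ i" "\<And>i. b $ i \<le> int n"
proof -
  have "int_box K" using assms unfolding tiling_def by blast
  then obtain a b where ab: "\<And>i. a $ i < b $ i" "K = lattice_box a b"
    unfolding int_box_def by blast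
  have "K \<subseteq> cbox 0 (\<chi> i. real n)" using T K unfolding tiling_def division_of_def by blast
  moreover have "(\<chi> i. of_int (a $ i)) \<in> K" "(\<chi> i. of_int (b $ i)) \<in> K"
    using ab(1) by (simp_all add: ab(2) mem_box_cart less_imp_le)
  ultimately have "(\<chi> i. of_int (a $ i)) \<in> cbox (0 :: real ^ 'a) (\<chi> i. real n)"
     "(\<chi> i. of_int (b $ i)) \<in> cbox (0 :: real ^ 'a) (\<chi> i. real n)"
    by blast+
  then have "0 \<le> real_of_int (a $ i)" "real_of_int (b $ i) \<le> real n" for i
    by (simp_all add: mem_box_cart)
  then have "0 \<le> a $ i" "b $ i \<le> int n" for i by (simp, metis of_int_le_iff of_int_of_nat_eq)
  then show ?thesis using that[of a b] ab side_lattice_box[OF ab(1)] by simp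
qed

lemma tiling_side:
  assumes "tiling n T" "K \<in> T"
  shows "side K i \<subseteq> {0..<int n}" "side K i \<noteq> {}" "finite (side K i)"
proof -
  obtain a b where ab: "\<And>i. a $ i < b $ i" "\<And>i. side K i = {a $ i ..< b $ i}"
    "\<And>i. 0 \<le> a $ i" "\<And>i. b $ i \<le> int n"
    by (rule tiling_box[OF assms]) blast
  show "side K i \<subseteq> {0..<int n}" "side K i \<noteq> {}" "finite (side K i)"
    using ab(1)[of i] ab(3)[of i] ab(4)[of i] by (auto simp: ab(2))
qed

text \<open>
  A tiling of a degenerate cube does not exist: that cube is a single point, which contains no
  box of positive side.
\<close>

lemma tiling_pos:
  assumes T: "tiling n T" shows "0 < n"
proof -
  have "0 \<in> \<Union>T" using T unfolding tiling_def by (auto simp: mem_box_cart dest!: division_ofD(6))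
  then obtain K where "K \<in> T" by blast
  then have "{0..<int n} \<noteq> {}" using tiling_side(1,2)[OF T] by blast
  then show ?thesis by simp
qed

lemma tiling_cell_unique:
  assumes T: "tiling n T" and "K \<in> T" "L \<in> T" "\<And>i. p $ i \<in> side K i" "\<And>i. p $ i \<in> side L i"
  shows "K = L"
proof (rule ccontr)
  assume "K \<noteq> L"
  then have "interior K \<inter> interior L = {}"
    using assms(1-3) unfolding tiling_def division_of_def by blast
  moreover have "cell_centre p \<in> interior M" if M: "M \<in> T" "\<And>i. p $ i \<in> side M i" for M
  proof -
    obtain a b where "M = lattice_box a b" "\<And>i. side M i = {a $ i ..< b $ i}"
      by (rule tiling_box[OF T M(1)]) blast
    then show ?thesis using cell_centre_in_interior[of p a b] M(2) by simp
  qed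
  ultimately show False using assms(2-5) by blast
qed

lemma tiling_cell_covered:
  assumes T: "tiling n T" and p: "\<And>i. p $ i \<in> {0..<int n}"
  obtains K where "K \<in> T" "\<And>i. p $ i \<in> side K i"
proof -
  have "cell_centre p \<in> lattice_box 0 (\<chi> i. int n)"
    unfolding cell_centre_in_box using p by simp
  moreover have "lattice_box 0 (\<chi> i. int n) = (cbox 0 (\<chi> i. real n) :: (real ^ 'a) set)"
    by (simp add: zero_vec_def)
  moreover have "\<Union>T = cbox 0 (\<chi> i. real n)" using T unfolding tiling_def by (auto dest: division_ofD(6))
  ultimately have "cell_centre p \<in> \<Union>T" by (simp only:)
  then obtain K where K: "K \<in> T" "cell_centre p \<in> K" by blast
  obtain a b where "K = lattice_box a b" "\<And>i. side K i = {a $ i ..< b $ i}"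
    by (rule tiling_box[OF T K(1)]) blast
  then have "p $ i \<in> side K i" for i using K(2) cell_centre_in_box by blast
  then show ?thesis using that K(1) by blast
qed

section \<open>Counting the separating facets\<close>

text \<open>
  The unit facet with least vertex \<open>p\<close> and normal direction \<open>k\<close>.
\<close>

definition facet :: "'d \<times> (int ^ 'd) \<Rightarrow> (real ^ 'd) set" where
  "facet = (\<lambda>(k, p). cbox (\<chi> i. of_int (p $ i)) (\<chi> i. of_int (p $ i) + (if i = k then 0 else 1)))"

lemma facet_eq_lattice_box:
  "facet (k, p) = lattice_box p (\<chi> i. p $ i + (if i = k then 0 else 1))"
  unfolding facet_def prod.case by (rule arg_cong2[where f = cbox]) (auto simp: vec_eq_iff)

lemma facet_subset_lattice_box:
  "facet (k, p) \<subseteq> lattice_box a b \<longleftrightarrow>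
     (\<forall>i. a $ i \<le> p $ i \<and> p $ i + (if i = k then 0 else 1) \<le> b $ i)"
proof -
  have "real_of_int x + 1 \<le> of_int y \<longleftrightarrow> x + 1 \<le> y" for x y :: int by linarith
  then show ?thesis unfolding facet_eq_lattice_box subset_interval_cart by simp
qed

lemma inj_facet: "inj (facet :: 'd \<times> (int ^ 'd) \<Rightarrow> (real ^ 'd::finite) set)"
proof (rule injI, clarsimp)
  fix k l :: 'd and p q :: "int ^ 'd"
  assume eq: "facet (k, p) = facet (l, q)"
  have le: "p $ i \<le> q $ i \<and> q $ i + (if i = l then 0 else 1) \<le> p $ i + (if i = k then 0 else 1)"
    if "facet (l, q) \<subseteq> facet (k, p)" for k l :: 'd and p q :: "int ^ 'd" and i
    using that unfolding facet_eq_lattice_box[of k p] facet_subset_lattice_box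
    unfolding vec_lambda_beta by blast
  have *: "p $ i = q $ i" "(if i = l then 0 else 1 :: int) = (if i = k then 0 else 1)" for i
    using conjunct1[OF le[of l q k p i]] conjunct1[OF le[of k p l q i]]
      conjunct2[OF le[of l q k p i]] conjunct2[OF le[of k p l q i]] eq by simp_all
  have "p = q" using *(1) by (simp add: vec_eq_iff)
  moreover have "k = l" using *(2)[of k] by (auto split: if_splits)
  ultimately show "k = l \<and> p = q" by simp
qed

text \<open>
  The cells of \<open>K\<close> that touch its lower face in direction \<open>k\<close>.
\<close>

definition lower_cells :: "(real ^ 'd) set \<Rightarrow> 'd \<Rightarrow> (int ^ 'd) set" where
  "lower_cells K k = {p. (\<forall>i. p $ i \<in> side K i) \<and> p $ k - 1 \<notin> side K k}"

text \<open>
  A facet separates two pieces iff it does not lie on the lower face of the big cube but on the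
  lower face of one piece: the piece below it is then a different one.
\<close>

lemma separating_facet_iff:
  assumes T: "tiling n T"
  shows "(\<exists>K\<in>T. \<exists>L\<in>T. K \<noteq> L \<and> facet (k, p) \<subseteq> K \<inter> L) \<longleftrightarrow>
    0 < p $ k \<and> (\<exists>K\<in>T. p \<in> lower_cells K k)"
proof
  assume "\<exists>K\<in>T. \<exists>L\<in>T. K \<noteq> L \<and> facet (k, p) \<subseteq> K \<inter> L"
  then obtain K L where KL: "K \<in> T" "L \<in> T" "K \<noteq> L" "facet (k, p) \<subseteq> K" "facet (k, p) \<subseteq> L" by blast
  obtain a b where K: "K = lattice_box a b" "\<And>i. side K i = {a $ i ..< b $ i}" "\<And>i. a $ i < b $ i"
    "\<And>i. 0 \<le> a $ i"
    by (rule tiling_box[OF T KL(1)]) blast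
  obtain c d where L: "L = lattice_box c d" "\<And>i. side L i = {c $ i ..< d $ i}" "\<And>i. c $ i < d $ i"
    "\<And>i. 0 \<le> c $ i"
    by (rule tiling_box[OF T KL(2)]) blast
  have ab: "a $ i \<le> p $ i \<and> p $ i + (if i = k then 0 else 1) \<le> b $ i"
    and cd: "c $ i \<le> p $ i \<and> p $ i + (if i = k then 0 else 1) \<le> d $ i" for i
    using KL(4,5) unfolding K(1) L(1) facet_subset_lattice_box by blast+
  have ab': "p $ i \<in> side K i" and cd': "p $ i \<in> side L i" if "i \<noteq> k" for i
    using ab[of i] cd[of i] that by (auto simp: K(2) L(2))
  have not_both: "\<not> (q \<in> side K k \<and> q \<in> side L k)" for q
  proof
    assume q: "q \<in> side K k \<and> q \<in> side L k"
    \<comment> \<open>the cell next to the facet, on the level \<open>q\<close>\<close>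
    let ?q = "\<chi> i. if i = k then q else p $ i"
    have "K = L"
      by (rule tiling_cell_unique[OF T KL(1,2), of ?q]) (use q ab' cd' in auto)
    with KL show False by simp
  qed
  have k: "a $ k \<le> p $ k" "p $ k \<le> b $ k" "c $ k \<le> p $ k" "p $ k \<le> d $ k" using ab[of k] cd[of k] by auto
  consider "a $ k = p $ k" | "c $ k = p $ k" | "a $ k < p $ k" "c $ k < p $ k" using k by linarith
  then show "0 < p $ k \<and> (\<exists>K\<in>T. p \<in> lower_cells K k)"
  proof cases
    case 1
    have "p $ i \<in> side K i" for i
      using ab' 1 K(3)[of k] by (cases "i = k") (auto simp: K(2))
    moreover have "p $ k - 1 \<notin> side K k" using 1 by (simp add: K(2))
    moreover have "c $ k < p $ k"
      using not_both[of "p $ k"] 1 K(3)[of k] L(3)[of k] k by (auto simp: K(2) L(2))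
    ultimately show ?thesis using KL(1) L(4)[of k] by (auto simp: lower_cells_def)
  next
    case 2
    have "p $ i \<in> side L i" for i
      using cd' 2 L(3)[of k] by (cases "i = k") (auto simp: L(2))
    moreover have "p $ k - 1 \<notin> side L k" using 2 by (simp add: L(2))
    moreover have "a $ k < p $ k"
      using not_both[of "p $ k"] 2 K(3)[of k] L(3)[of k] k by (auto simp: K(2) L(2))
    ultimately show ?thesis using KL(2) K(4)[of k] by (auto simp: lower_cells_def)
  next
    case 3
    then show ?thesis using not_both[of "p $ k - 1"] k by (auto simp: K(2) L(2))
  qed
next
  assume "0 < p $ k \<and> (\<exists>K\<in>T. p \<in> lower_cells K k)"
  then obtain K where K: "0 < p $ k" "K \<in> T" "\<And>i. p $ i \<in> side K i" "p $ k - 1 \<notin> side K k"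
    by (auto simp: lower_cells_def)
  \<comment> \<open>the cell below the facet\<close>
  let ?q = "\<chi> i. if i = k then p $ k - 1 else p $ i"
  have pn: "p $ i \<in> {0..<int n}" for i using tiling_side(1)[OF T K(2)] K(3) by blast
  have "?q $ i \<in> {0..<int n}" for i using pn[of i] K(1) by auto
  then obtain L where L: "L \<in> T" "\<And>i. ?q $ i \<in> side L i" using tiling_cell_covered[OF T] by blast
  have "K \<noteq> L" using K(4) L(2)[of k] by auto
  moreover have "facet (k, p) \<subseteq> K"
  proof -
    obtain a b where ab: "K = lattice_box a b" "\<And>i. side K i = {a $ i ..< b $ i}"
      by (rule tiling_box[OF T K(2)]) blast
    show ?thesis unfolding ab(1) facet_subset_lattice_box
    proof
      fix i show "a $ i \<le> p $ i \<and> p $ i + (if i = k then 0 else 1) \<le> b $ i"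
        using K(3)[of i] by (auto simp: ab(2))
    qed
  qed
  moreover have "facet (k, p) \<subseteq> L"
  proof -
    obtain a b where ab: "L = lattice_box a b" "\<And>i. side L i = {a $ i ..< b $ i}"
      by (rule tiling_box[OF T L(1)]) blast
    show ?thesis unfolding ab(1) facet_subset_lattice_box
    proof
      fix i show "a $ i \<le> p $ i \<and> p $ i + (if i = k then 0 else 1) \<le> b $ i"
        using L(2)[of i] by (auto simp: ab(2) split: if_splits)
    qed
  qed
  ultimately show "\<exists>K\<in>T. \<exists>L\<in>T. K \<noteq> L \<and> facet (k, p) \<subseteq> K \<inter> L" using K(2) L(1) by blast
qed

lemma card_vec_set:
  fixes S :: "'d::finite \<Rightarrow> 'b set"
  shows "card {p :: 'b ^ 'd. \<forall>i. p $ i \<in> S i} = (\<Prod>i\<in>UNIV. card (S i))"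
proof -
  have "bij_betw vec_nth {p :: 'b ^ 'd. \<forall>i. p $ i \<in> S i} (\<Pi>\<^sub>E i\<in>UNIV. S i)"
    by (rule bij_betwI[where g = vec_lambda]) (auto simp: PiE_def Pi_def)
  then show ?thesis by (simp add: bij_betw_same_card card_PiE)
qed

lemma finite_vec_set:
  fixes S :: "'d::finite \<Rightarrow> 'b set"
  assumes "\<And>i. finite (S i)"
  shows "finite {p :: 'b ^ 'd. \<forall>i. p $ i \<in> S i}"
proof -
  have "{p :: 'b ^ 'd. \<forall>i. p $ i \<in> S i} \<subseteq> vec_lambda ` (\<Pi>\<^sub>E i\<in>UNIV. S i)"
  proof
    fix p :: "'b ^ 'd" assume "p \<in> {p. \<forall>i. p $ i \<in> S i}"
    then have "vec_nth p \<in> (\<Pi>\<^sub>E i\<in>UNIV. S i)" by auto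
    then show "p \<in> vec_lambda ` (\<Pi>\<^sub>E i\<in>UNIV. S i)" by (metis imageI vec_nth_inverse)
  qed
  then show ?thesis using assms finite_PiE[of UNIV S] finite_surj by auto
qed

lemma lower_cells_eq:
  assumes "tiling n T" "K \<in> T"
  obtains x where "lower_cells K k = {p. \<forall>i. p $ i \<in> (if i = k then {x} else side K i)}"
proof -
  obtain a b where ab: "\<And>i. side K i = {a $ i ..< b $ i}" "\<And>i. a $ i < b $ i"
    by (rule tiling_box[OF assms]) blast
  have "lower_cells K k = {p. \<forall>i. p $ i \<in> (if i = k then {a $ k} else side K i)}"
  proof (rule set_eqI)
    fix p
    show "p \<in> lower_cells K k \<longleftrightarrow> p \<in> {p. \<forall>i. p $ i \<in> (if i = k then {a $ k} else side K i)}"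
    proof
      assume "p \<in> lower_cells K k"
      then have "\<And>i. p $ i \<in> side K i" "p $ k - 1 \<notin> side K k" by (auto simp: lower_cells_def)
      moreover have "p $ k = a $ k"
        using calculation(1)[of k] calculation(2) unfolding ab(1) atLeastLessThan_iff by linarith
      ultimately show "p \<in> {p. \<forall>i. p $ i \<in> (if i = k then {a $ k} else side K i)}" by auto
    next
      assume "p \<in> {p. \<forall>i. p $ i \<in> (if i = k then {a $ k} else side K i)}"
      then have p: "p $ i \<in> (if i = k then {a $ k} else side K i)" for i by blast
      have "p $ i \<in> side K i" for i using p[of i] ab(2)[of k] by (cases "i = k") (auto simp: ab(1))
      then show "p \<in> lower_cells K k" using p[of k] by (auto simp: lower_cells_def ab(1))
    qed
  qed
  then show ?thesis using that by blast
qed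

lemma prod_if_remove:
  fixes f :: "'d::finite \<Rightarrow> nat"
  shows "(\<Prod>i\<in>UNIV. if i = k then 1 else f i) = (\<Prod>i\<in>UNIV - {k}. f i)"
  by (simp add: prod.remove[of UNIV k])

lemma
  assumes "tiling n T" "K \<in> T"
  shows card_lower_cells: "card (lower_cells K k) = (\<Prod>i\<in>UNIV - {k}. card (side K i))"
    and finite_lower_cells: "finite (lower_cells K k)"
proof -
  obtain x where x: "lower_cells K k = {p. \<forall>i. p $ i \<in> (if i = k then {x} else side K i)}"
    by (rule lower_cells_eq[OF assms])
  show "card (lower_cells K k) = (\<Prod>i\<in>UNIV - {k}. card (side K i))"
    unfolding x card_vec_set prod_if_remove[symmetric] by (intro prod.cong) auto
  show "finite (lower_cells K k)"
    unfolding x by (rule finite_vec_set) (use tiling_side(3)[OF assms] in auto)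
qed

text \<open>
  In direction \<open>k\<close>, every piece has as many cells on its lower face as the product of its other
  sides; the \<open>n ^ (CARD('d) - 1)\<close> cells on the lower face of the big cube do not count.
\<close>

lemma interface_eq:
  fixes T :: "(real ^ 'd) set set"
  assumes T: "tiling n T"
  shows "interface T + CARD('d) * n ^ (CARD('d) - 1) =
    (\<Sum>k\<in>UNIV. \<Sum>K\<in>T. \<Prod>i\<in>UNIV - {k}. card (side K i))"
proof -
  have n: "0 < n" by (rule tiling_pos[OF T])
  define E F B where "E k = (\<Union>K\<in>T. lower_cells K k)"
    and "F k = {p \<in> E k. 0 < p $ k}" and "B k = {p \<in> E k. p $ k \<le> 0}" for k
  have finT: "finite T" using T unfolding tiling_def division_of_def by blast
  have finE: "finite (E k)" for k using finT finite_lower_cells[OF T] by (auto simp: E_def)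
  have "card (E k) = (\<Sum>K\<in>T. \<Prod>i\<in>UNIV - {k}. card (side K i))" for k
  proof -
    have "card (E k) = (\<Sum>K\<in>T. card (lower_cells K k))"
      unfolding E_def
    proof (rule card_UN_disjoint[OF finT])
      show "\<forall>K\<in>T. finite (lower_cells K k)" using finite_lower_cells[OF T] by blast
      show "\<forall>K\<in>T. \<forall>L\<in>T. K \<noteq> L \<longrightarrow> lower_cells K k \<inter> lower_cells L k = {}"
        using tiling_cell_unique[OF T] unfolding lower_cells_def by blast
    qed
    then show ?thesis by (simp add: card_lower_cells[OF T])
  qed
  moreover have "card (E k) = card (F k) + card (B k)" for k
  proof -
    have "E k = F k \<union> B k" "F k \<inter> B k = {}" by (auto simp: F_def B_def)
    moreover have "finite (F k)" "finite (B k)" using finE by (auto simp: F_def B_def)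
    ultimately show ?thesis by (simp add: card_Un_disjoint)
  qed
  moreover have "card (B k) = n ^ (CARD('d) - 1)" for k
  proof -
    have "B k = {p. \<forall>i. p $ i \<in> (if i = k then {0} else {0..<int n})}"
    proof (intro set_eqI iffI)
      fix p assume "p \<in> B k"
      then obtain K where K: "K \<in> T" "\<And>i. p $ i \<in> side K i" "p $ k \<le> 0"
        by (auto simp: B_def E_def lower_cells_def)
      have "p $ i \<in> {0..<int n}" for i using tiling_side(1)[OF T K(1)] K(2) by blast
      moreover from this[of k] K(3) have "p $ k = 0" by simp
      ultimately show "p \<in> {p. \<forall>i. p $ i \<in> (if i = k then {0} else {0..<int n})}" by auto
    next
      fix p assume "p \<in> {p. \<forall>i. p $ i \<in> (if i = k then {0} else {0..<int n})}"
      then have p: "p $ i \<in> (if i = k then {0} else {0..<int n})" for i by blast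
      have "p $ i \<in> {0..<int n}" for i using p[of i] n by (auto split: if_splits)
      then obtain K where K: "K \<in> T" "\<And>i. p $ i \<in> side K i" using tiling_cell_covered[OF T] by blast
      have "p $ k = 0" using p[of k] by (auto split: if_splits)
      moreover have "- 1 \<notin> side K k" using tiling_side(1)[OF T K(1), of k] by auto
      ultimately have "p \<in> lower_cells K k" using K(2) by (simp add: lower_cells_def)
      then show "p \<in> B k" using K(1) \<open>p $ k = 0\<close> by (auto simp: B_def E_def)
    qed
    then have "card (B k) = (\<Prod>i\<in>UNIV. card (if i = k then {0} else {0..<int n}))"
      by (simp only: card_vec_set)
    also have "\<dots> = (\<Prod>i\<in>UNIV. if i = k then 1 else n)" by (intro prod.cong) auto
    also have "\<dots> = n ^ (CARD('d) - 1)" unfolding prod_if_remove by (simp add: card_Diff_singleton)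
    finally show ?thesis .
  qed
  moreover have "interface T = (\<Sum>k\<in>UNIV. card (F k))"
  proof -
    have "{G. unit_facet G \<and> (\<exists>K\<in>T. \<exists>L\<in>T. K \<noteq> L \<and> G \<subseteq> K \<inter> L)} = facet ` (SIGMA k:UNIV. F k)"
    proof (intro set_eqI iffI)
      fix G assume G: "G \<in> {G. unit_facet G \<and> (\<exists>K\<in>T. \<exists>L\<in>T. K \<noteq> L \<and> G \<subseteq> K \<inter> L)}"
      then obtain p k where "G = facet (k, p)" by (auto simp: unit_facet_def facet_def)
      with G have "0 < p $ k \<and> (\<exists>K\<in>T. p \<in> lower_cells K k)"
        using separating_facet_iff[OF T, of k p] by blast
      then have "(k, p) \<in> (SIGMA k:UNIV. F k)" by (auto simp: F_def E_def)
      then show "G \<in> facet ` (SIGMA k:UNIV. F k)" using \<open>G = facet (k, p)\<close> by blast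
    next
      fix G assume "G \<in> facet ` (SIGMA k:UNIV. F k)"
      then obtain k p where G: "G = facet (k, p)" "p \<in> F k" by blast
      then have "\<exists>K\<in>T. \<exists>L\<in>T. K \<noteq> L \<and> G \<subseteq> K \<inter> L"
        using separating_facet_iff[OF T, of k p] by (auto simp: F_def E_def)
      moreover have "unit_facet G" by (auto simp: unit_facet_def facet_def G(1))
      ultimately show "G \<in> {G. unit_facet G \<and> (\<exists>K\<in>T. \<exists>L\<in>T. K \<noteq> L \<and> G \<subseteq> K \<inter> L)}" by blast
    qed
    then have "interface T = card (facet ` (SIGMA k:UNIV. F k))" by (simp add: interface_def)
    also have "\<dots> = card (SIGMA k:UNIV. F k)"
      using inj_facet by (intro card_image) (auto intro: inj_on_subset)
    also have "\<dots> = (\<Sum>k\<in>UNIV. card (F k))" using finE by (intro card_SigmaI) (auto simp: F_def)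
    finally show ?thesis .
  qed
  ultimately show ?thesis by (simp add: sum.distrib flip: \<open>\<And>k. card (E k) = (\<Sum>K\<in>T. \<Prod>i\<in>UNIV - {k}. card (side K i))\<close>)
qed

section \<open>Lower bounds for tilings of the square and the cube\<close>

lemma UNIV_minus_2: "UNIV - {1 :: 2} = {2}" "UNIV - {2 :: 2} = {1}"
  unfolding UNIV_2 by auto

lemma UNIV_minus_3: "UNIV - {1 :: 3} = {2, 3}" "UNIV - {2 :: 3} = {3, 1}" "UNIV - {3 :: 3} = {1, 2}"
  unfolding UNIV_3 by auto

lemma interface_square:
  fixes T :: "(real ^ 2) set set"
  assumes "tiling n T"
  shows "interface T + 2 * n = (\<Sum>K\<in>T. card (side K 1) + card (side K 2))"
proof -
  have "interface T + 2 * n = (\<Sum>K\<in>T. card (side K 2)) + (\<Sum>K\<in>T. card (side K 1))"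
    using interface_eq[OF assms] unfolding sum_2 UNIV_minus_2 by simp
  then show ?thesis by (simp add: sum.distrib)
qed

lemma interface_cube:
  fixes T :: "(real ^ 3) set set"
  assumes "tiling n T"
  shows "interface T + 3 * n\<^sup>2 = (\<Sum>K\<in>T. surface (\<lambda>K. side K 1) (\<lambda>K. side K 2) (\<lambda>K. side K 3) K)"
proof -
  have "interface T + 3 * n\<^sup>2 = (\<Sum>K\<in>T. card (side K 2) * card (side K 3)) +
      (\<Sum>K\<in>T. card (side K 3) * card (side K 1)) + (\<Sum>K\<in>T. card (side K 1) * card (side K 2))"
    using interface_eq[OF assms] unfolding sum_3 UNIV_minus_3 by simp
  then show ?thesis by (simp add: sum.distrib)
qed

lemma tiling_cell_ex1:
  assumes T: "tiling n T" and p: "\<And>i. p $ i \<in> {0..<int n}"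
  shows "\<exists>!K. K \<in> T \<and> (\<forall>i. p $ i \<in> side K i)"
proof -
  obtain K where "K \<in> T" "\<And>i. p $ i \<in> side K i" using tiling_cell_covered[OF T p] by blast
  then show ?thesis using tiling_cell_unique[OF T] by blast
qed

lemma tiling_finite: "tiling n T \<Longrightarrow> finite T"
  unfolding tiling_def by (auto dest: division_ofD(1))

lemma tiling_partition2:
  fixes T :: "(real ^ 2) set set"
  assumes T: "tiling n T"
  shows "partition2 {0..<int n} T (\<lambda>K. side K 1) (\<lambda>K. side K 2)"
proof -
  have "\<exists>!K. K \<in> T \<and> x \<in> side K 1 \<and> y \<in> side K 2" if "x \<in> {0..<int n}" "y \<in> {0..<int n}" for x y
  proof -
    have "(vector [x, y] :: int ^ 2) $ i \<in> {0..<int n}" for i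
      using that exhaust_2[of i] by (auto simp: vector_2)
    from tiling_cell_ex1[OF T this] show ?thesis by (simp add: forall_2 vector_2)
  qed
  then show ?thesis
    using tiling_finite[OF T] tiling_side[OF T] by (simp add: partition2_def)
qed

lemma tiling_partition3:
  fixes T :: "(real ^ 3) set set"
  assumes T: "tiling n T"
  shows "partition3 {0..<int n} T (\<lambda>K. side K 1) (\<lambda>K. side K 2) (\<lambda>K. side K 3)"
proof -
  have "\<exists>!K. K \<in> T \<and> x \<in> side K 1 \<and> y \<in> side K 2 \<and> z \<in> side K 3"
    if "x \<in> {0..<int n}" "y \<in> {0..<int n}" "z \<in> {0..<int n}" for x y z
  proof -
    have "(vector [x, y, z] :: int ^ 3) $ i \<in> {0..<int n}" for i
      using that exhaust_3[of i] by (auto simp: vector_3)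
    from tiling_cell_ex1[OF T this] show ?thesis by (simp add: forall_3 vector_3)
  qed
  then show ?thesis
    using tiling_finite[OF T] tiling_side[OF T] by (simp add: partition3_def)
qed

lemma dims_square:
  fixes K :: "(real ^ 2) set"
  assumes "int_box K"
  shows "dims K = image_mset real {#card (side K 1), card (side K 2)#}"
  unfolding dims_int_box[OF assms] UNIV_2 by simp

lemma dims_cube:
  fixes K :: "(real ^ 3) set"
  assumes "int_box K"
  shows "dims K = image_mset real {#card (side K 1), card (side K 2), card (side K 3)#}"
  unfolding dims_int_box[OF assms] UNIV_3 by simp

lemma inj_image_mset_real: "inj (image_mset real)"
  by (rule multiset.inj_map) (simp add: inj_on_def)

lemma distinct_dims_square:
  fixes T :: "(real ^ 2) set set"
  assumes "tiling n T"
  shows "distinct_dims T \<longleftrightarrow> inj_on (\<lambda>K. {#card (side K 1), card (side K 2)#}) T"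
proof -
  have "inj_on dims T \<longleftrightarrow> inj_on (image_mset real \<circ> (\<lambda>K. {#card (side K 1), card (side K 2)#})) T"
    using assms by (intro inj_on_cong) (simp add: dims_square tiling_def)
  also have "\<dots> \<longleftrightarrow> inj_on (\<lambda>K. {#card (side K 1), card (side K 2)#}) T"
    using comp_inj_on[OF _ inj_on_subset[OF inj_image_mset_real subset_UNIV]] inj_on_imageI2 by blast
  finally show ?thesis by (simp add: distinct_dims_def)
qed

lemma distinct_dims_cube:
  fixes T :: "(real ^ 3) set set"
  assumes "tiling n T"
  shows "distinct_dims T \<longleftrightarrow> inj_on (\<lambda>K. {#card (side K 1), card (side K 2), card (side K 3)#}) T"
proof -
  have "inj_on dims T \<longleftrightarrow>
      inj_on (image_mset real \<circ> (\<lambda>K. {#card (side K 1), card (side K 2), card (side K 3)#})) T"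
    using assms by (intro inj_on_cong) (simp add: dims_cube tiling_def)
  also have "\<dots> \<longleftrightarrow> inj_on (\<lambda>K. {#card (side K 1), card (side K 2), card (side K 3)#}) T"
    using comp_inj_on[OF _ inj_on_subset[OF inj_image_mset_real subset_UNIV]] inj_on_imageI2 by blast
  finally show ?thesis by (simp add: distinct_dims_def)
qed

lemma interface_square_lower:
  fixes T :: "(real ^ 2) set set"
  assumes "tiling n T" "distinct_dims T" "small_case n (card T) c"
  shows "n + c \<le> interface T"
proof -
  have "3 * card {0..<int n} + c \<le> (\<Sum>K\<in>T. card (side K 1) + card (side K 2))"
    using assms distinct_dims_square[OF assms(1)]
    by (intro partition2_perimeter_lower tiling_partition2) auto
  then show ?thesis using interface_square[OF assms(1)] by simp
qed

lemma interface_cube_lower: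
  fixes T :: "(real ^ 3) set set"
  assumes "tiling n T" "distinct_dims T" "card T = Suc m" "small_case n m c"
  shows "n\<^sup>2 + n + c \<le> interface T"
proof -
  have "4 * (card {0..<int n})\<^sup>2 + card {0..<int n} + c \<le>
      (\<Sum>K\<in>T. surface (\<lambda>K. side K 1) (\<lambda>K. side K 2) (\<lambda>K. side K 3) K)"
    using assms distinct_dims_cube[OF assms(1)]
    by (intro partition3_surface_lower[where m = m] tiling_partition3) auto
  then show ?thesis using interface_cube[OF assms(1)] by simp
qed

section \<open>Constructions of tilings\<close>

text \<open>
  Integer boxes that cover each cell exactly once form a tiling.
\<close>

lemma tiling_of_boxes:
  fixes lo hi :: "'i \<Rightarrow> int ^ 'd"
  assumes n: "0 < n" and fin: "finite I"
    and bounds: "\<And>i k. i \<in> I \<Longrightarrow> 0 \<le> lo i $ k \<and> lo i $ k < hi i $ k \<and> hi i $ k \<le> int n"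
    and cover: "\<And>p. \<forall>k. p $ k \<in> {0..<int n} \<Longrightarrow> \<exists>!i. i \<in> I \<and> (\<forall>k. p $ k \<in> {lo i $ k ..< hi i $ k})"
  shows "tiling n ((\<lambda>i. lattice_box (lo i) (hi i)) ` I)"
    and "inj_on (\<lambda>i. lattice_box (lo i) (hi i)) I"
proof -
  let ?K = "\<lambda>i. lattice_box (lo i) (hi i)"
  have eqI: "i = j" if ij: "i \<in> I" "j \<in> I" and p: "\<And>k. p $ k \<in> {lo i $ k ..< hi i $ k}"
    "\<And>k. p $ k \<in> {lo j $ k ..< hi j $ k}" for i j p
  proof -
    have "\<forall>k. p $ k \<in> {0..<int n}"
    proof
      fix k show "p $ k \<in> {0..<int n}" using bounds[OF ij(1), of k] p(1)[of k] by auto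
    qed
    from cover[OF this] show ?thesis using ij p by blast
  qed
  have side: "side (?K i) k = {lo i $ k ..< hi i $ k}" if "i \<in> I" for i k
    using bounds[OF that] by (intro side_lattice_box) blast
  show "inj_on ?K I"
  proof (rule inj_onI)
    fix i j assume ij: "i \<in> I" "j \<in> I" "?K i = ?K j"
    have "{lo i $ k ..< hi i $ k} = {lo j $ k ..< hi j $ k}" for k
      using side[OF ij(1), of k] side[OF ij(2), of k] ij(3) by simp
    moreover have "lo i $ k \<in> {lo i $ k ..< hi i $ k}" for k using bounds[OF ij(1), of k] by simp
    ultimately show "i = j" using eqI[OF ij(1,2), of "lo i"] by blast
  qed
  have boxes: "int_box (?K i)" "?K i \<subseteq> cbox 0 (\<chi> k. real n)" "?K i \<noteq> {}" if "i \<in> I" for i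
  proof -
    note b = bounds[OF that]
    show "int_box (?K i)" using b unfolding int_box_def by blast
    show "?K i \<subseteq> cbox 0 (\<chi> k. real n)"
    proof
      fix x assume x: "x \<in> ?K i"
      show "x \<in> cbox 0 (\<chi> k. real n)" unfolding mem_box_cart
      proof
        fix k
        have "real_of_int (lo i $ k) \<le> x $ k" "x $ k \<le> of_int (hi i $ k)"
          using x by (simp_all add: lattice_box_iff)
        then show "(0 :: real ^ 'd) $ k \<le> x $ k \<and> x $ k \<le> (\<chi> k. real n) $ k"
          using b[of k] by simp
      qed
    qed
    show "?K i \<noteq> {}" using b by (simp add: interval_ne_empty_cart less_imp_le)
  qed
  have disj: "interior (?K i) \<inter> interior (?K j) = {}" if "i \<in> I" "j \<in> I" "?K i \<noteq> ?K j" for i j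
  proof (rule ccontr)
    assume "\<not> ?thesis"
    then obtain x where x: "x \<in> interior (?K i)" "x \<in> interior (?K j)" by blast
    let ?p = "\<chi> k. \<lfloor>x $ k\<rfloor>"
    have "?p $ k \<in> {lo l $ k ..< hi l $ k}" if "x \<in> interior (?K l)" for l k
    proof -
      have "real_of_int (lo l $ k) < x $ k" "x $ k < of_int (hi l $ k)"
        using that unfolding interior_lattice_box_iff by blast+
      then show ?thesis by (simp add: le_floor_iff floor_less_iff)
    qed
    then have "i = j" using eqI[OF that(1,2), of ?p] x by blast
    with that(3) show False by simp
  qed
  have union: "\<Union>(?K ` I) = cbox 0 (\<chi> k. real n)"
  proof
    show "\<Union>(?K ` I) \<subseteq> cbox 0 (\<chi> k. real n)" using boxes(2) by blast
    show "cbox 0 (\<chi> k. real n) \<subseteq> \<Union>(?K ` I)"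
    proof
      fix x :: "real ^ 'd" assume "x \<in> cbox 0 (\<chi> k. real n)"
      then have x: "0 \<le> x $ k" "x $ k \<le> real n" for k by (simp_all add: mem_box_cart)
      \<comment> \<open>the minimum assigns points of the upper boundary of the cube to the last cell\<close>
      let ?p = "\<chi> k. min \<lfloor>x $ k\<rfloor> (int n - 1)"
      have "\<forall>k. ?p $ k \<in> {0..<int n}" using x n by auto
      from cover[OF this] obtain i where i: "i \<in> I" "\<And>k. ?p $ k \<in> {lo i $ k ..< hi i $ k}" by blast
      have "real_of_int (lo i $ k) \<le> x $ k \<and> x $ k \<le> of_int (hi i $ k)" for k
      proof -
        have p: "lo i $ k \<le> min \<lfloor>x $ k\<rfloor> (int n - 1)" "min \<lfloor>x $ k\<rfloor> (int n - 1) < hi i $ k"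
          using i(2)[of k] by simp_all
        then have "lo i $ k \<le> \<lfloor>x $ k\<rfloor>" by simp
        moreover have "\<lfloor>x $ k\<rfloor> < hi i $ k \<or> int n \<le> hi i $ k" using p(2) by linarith
        then have "x $ k \<le> of_int (hi i $ k)"
        proof
          assume "\<lfloor>x $ k\<rfloor> < hi i $ k"
          then show ?thesis by (simp add: floor_less_iff)
        next
          assume "int n \<le> hi i $ k"
          then show ?thesis using x(2)[of k] by linarith
        qed
        ultimately show ?thesis by (simp add: le_floor_iff)
      qed
      then have "x \<in> ?K i" by (simp add: lattice_box_iff)
      then show "x \<in> \<Union>(?K ` I)" using i(1) by blast
    qed
  qed
  have "?K ` I division_of cbox 0 (\<chi> k. real n)"
  proof (rule division_ofI)
    show "finite (?K ` I)" using fin by simp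
    show "\<Union>(?K ` I) = cbox 0 (\<chi> k. real n)" by (rule union)
  next
    fix K assume "K \<in> ?K ` I"
    then obtain i where "i \<in> I" "K = ?K i" by blast
    then show "K \<subseteq> cbox 0 (\<chi> k. real n)" "K \<noteq> {}"
      using boxes(2,3)[of i] by (simp_all only: not_False_eq_True)
    show "\<exists>a b. K = cbox a b" unfolding \<open>K = ?K i\<close> by blast
  next
    fix K L assume "K \<in> ?K ` I" "L \<in> ?K ` I" "K \<noteq> L"
    then obtain i j where "i \<in> I" "j \<in> I" and KL: "K = ?K i" "L = ?K j" by blast
    with \<open>K \<noteq> L\<close> show "interior K \<inter> interior L = {}" unfolding KL by (intro disj)
  qed
  then show "tiling n (?K ` I)" unfolding tiling_def using boxes(1) by simp
qed

lemma square_tiling_exists: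
  fixes x x' y y' :: "'i \<Rightarrow> int"
  assumes n: "0 < n" and P: "partition2 {0..<int n} I (\<lambda>i. {x i..<x' i}) (\<lambda>i. {y i..<y' i})"
    and inj: "inj_on (\<lambda>i. {#nat (x' i - x i), nat (y' i - y i)#}) I"
  shows "\<exists>T :: (real ^ 2) set set. tiling n T \<and> card T = card I \<and> distinct_dims T \<and>
    interface T + 2 * n = (\<Sum>i\<in>I. nat (x' i - x i) + nat (y' i - y i))"
proof -
  define lo hi K where "lo i = (vector [x i, y i] :: int ^ 2)" and "hi i = (vector [x' i, y' i] :: int ^ 2)"
    and "K i = lattice_box (lo i) (hi i)" for i
  have fin: "finite I" using P by (simp add: partition2_def)
  have bounds: "0 \<le> lo i $ k \<and> lo i $ k < hi i $ k \<and> hi i $ k \<le> int n" if "i \<in> I" for i k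
    using partition2_sides[OF P that] exhaust_2[of k] by (auto simp: lo_def hi_def vector_2)
  have cover: "\<exists>!i. i \<in> I \<and> (\<forall>k. p $ k \<in> {lo i $ k ..< hi i $ k})"
    if "\<forall>k. p $ k \<in> {0..<int n}" for p
  proof -
    have "\<exists>!i. i \<in> I \<and> p $ 1 \<in> {x i..<x' i} \<and> p $ 2 \<in> {y i..<y' i}"
      using P that unfolding partition2_def by blast
    then show ?thesis by (simp add: forall_2 lo_def hi_def vector_2)
  qed
  have T: "tiling n (K ` I)" and injK: "inj_on K I"
    unfolding K_def using tiling_of_boxes[OF n fin bounds cover] by blast+
  have side: "side (K i) k = {lo i $ k ..< hi i $ k}" if "i \<in> I" for i k
    unfolding K_def using bounds[OF that] by (intro side_lattice_box) blast
  have sides: "card (side (K i) 1) = nat (x' i - x i)" "card (side (K i) 2) = nat (y' i - y i)"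
    if "i \<in> I" for i by (simp_all add: side[OF that] lo_def hi_def vector_2)
  have "inj_on (\<lambda>i. {#card (side (K i) 1), card (side (K i) 2)#}) I"
    using inj by (subst inj_on_cong[of I _ "\<lambda>i. {#nat (x' i - x i), nat (y' i - y i)#}"]) (simp_all add: sides)
  then have "distinct_dims (K ` I)"
    unfolding distinct_dims_square[OF T] by (auto simp: inj_on_def)
  moreover have "interface (K ` I) + 2 * n = (\<Sum>i\<in>I. nat (x' i - x i) + nat (y' i - y i))"
    unfolding interface_square[OF T] by (simp add: sum.reindex[OF injK] sides)
  ultimately show ?thesis using T card_image[OF injK] by blast
qed

lemma cube_tiling_exists:
  fixes x x' y y' z z' :: "'i \<Rightarrow> int"
  assumes n: "0 < n"
    and P: "partition3 {0..<int n} I (\<lambda>i. {x i..<x' i}) (\<lambda>i. {y i..<y' i}) (\<lambda>i. {z i..<z' i})"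
    and inj: "inj_on (\<lambda>i. {#nat (x' i - x i), nat (y' i - y i), nat (z' i - z i)#}) I"
  shows "\<exists>T :: (real ^ 3) set set. tiling n T \<and> card T = card I \<and> distinct_dims T \<and>
    interface T + 3 * n\<^sup>2 =
      (\<Sum>i\<in>I. surface (\<lambda>i. {x i..<x' i}) (\<lambda>i. {y i..<y' i}) (\<lambda>i. {z i..<z' i}) i)"
proof -
  define lo hi K where "lo i = (vector [x i, y i, z i] :: int ^ 3)"
    and "hi i = (vector [x' i, y' i, z' i] :: int ^ 3)"
    and "K i = lattice_box (lo i) (hi i)" for i
  have fin: "finite I" using P by (simp add: partition3_def)
  have bounds: "0 \<le> lo i $ k \<and> lo i $ k < hi i $ k \<and> hi i $ k \<le> int n" if "i \<in> I" for i k
    using partition3_sides[OF P that] exhaust_3[of k] by (auto simp: lo_def hi_def vector_3)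
  have cover: "\<exists>!i. i \<in> I \<and> (\<forall>k. p $ k \<in> {lo i $ k ..< hi i $ k})"
    if "\<forall>k. p $ k \<in> {0..<int n}" for p
  proof -
    have "\<exists>!i. i \<in> I \<and> p $ 1 \<in> {x i..<x' i} \<and> p $ 2 \<in> {y i..<y' i} \<and> p $ 3 \<in> {z i..<z' i}"
      using P that unfolding partition3_def by blast
    then show ?thesis by (simp add: forall_3 lo_def hi_def vector_3)
  qed
  have T: "tiling n (K ` I)" and injK: "inj_on K I"
    unfolding K_def using tiling_of_boxes[OF n fin bounds cover] by blast+
  have side: "side (K i) k = {lo i $ k ..< hi i $ k}" if "i \<in> I" for i k
    unfolding K_def using bounds[OF that] by (intro side_lattice_box) blast
  have sides: "card (side (K i) 1) = nat (x' i - x i)" "card (side (K i) 2) = nat (y' i - y i)"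
    "card (side (K i) 3) = nat (z' i - z i)"
    if "i \<in> I" for i by (simp_all add: side[OF that] lo_def hi_def vector_3)
  have "inj_on (\<lambda>i. {#card (side (K i) 1), card (side (K i) 2), card (side (K i) 3)#}) I"
    using inj
    by (subst inj_on_cong[of I _ "\<lambda>i. {#nat (x' i - x i), nat (y' i - y i), nat (z' i - z i)#}"])
      (simp_all add: sides)
  then have "distinct_dims (K ` I)"
    unfolding distinct_dims_cube[OF T] by (auto simp: inj_on_def)
  moreover have "interface (K ` I) + 3 * n\<^sup>2 =
      (\<Sum>i\<in>I. surface (\<lambda>i. {x i..<x' i}) (\<lambda>i. {y i..<y' i}) (\<lambda>i. {z i..<z' i}) i)"
    unfolding interface_cube[OF T] by (simp add: sum.reindex[OF injK] sides)
  ultimately show ?thesis using T card_image[OF injK] by blast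
qed

lemma partition2_rectanglesI:
  fixes R :: "(int \<times> int \<times> int \<times> int) set"
  assumes "finite R"
    and sides: "\<forall>(a, b, c, d)\<in>R. 0 \<le> a \<and> a < b \<and> b \<le> n \<and> 0 \<le> c \<and> c < d \<and> d \<le> n"
    and cover: "\<And>x y. 0 \<le> x \<Longrightarrow> x < n \<Longrightarrow> 0 \<le> y \<Longrightarrow> y < n \<Longrightarrow>
      \<exists>(a, b, c, d)\<in>R. a \<le> x \<and> x < b \<and> c \<le> y \<and> y < d"
    and disj: "\<forall>(a, b, c, d)\<in>R. \<forall>(a', b', c', d')\<in>R.
      a < b' \<and> a' < b \<and> c < d' \<and> c' < d \<longrightarrow> (a, b, c, d) = (a', b', c', d')"
  shows "partition2 {0..<n} R (\<lambda>(a, b, c, d). {a..<b}) (\<lambda>(a, b, c, d). {c..<d})"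
proof -
  let ?X = "\<lambda>(a :: int, b :: int, c :: int, d :: int). {a..<b}"
  let ?Y = "\<lambda>(a :: int, b :: int, c :: int, d :: int). {c..<d}"
  have unique: "r = r'" if "r \<in> R" "r' \<in> R" "x \<in> ?X r" "y \<in> ?Y r" "x \<in> ?X r'" "y \<in> ?Y r'" for r r' x y
  proof -
    obtain a b c d a' b' c' d' where eq: "r = (a, b, c, d)" "r' = (a', b', c', d')"
      by (metis prod_cases4)
    have "a < b' \<and> a' < b \<and> c < d' \<and> c' < d" using that(3-6) unfolding eq by simp
    then show ?thesis using bspec[OF bspec[OF disj that(1), unfolded eq prod.case] that(2)] by (simp add: eq)
  qed
  have "\<exists>!r. r \<in> R \<and> x \<in> ?X r \<and> y \<in> ?Y r" if xy: "x \<in> {0..<n}" "y \<in> {0..<n}" for x y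
  proof -
    obtain r where r: "r \<in> R" "case r of (a, b, c, d) \<Rightarrow> a \<le> x \<and> x < b \<and> c \<le> y \<and> y < d"
      using cover[of x y] xy by auto
    then have "r \<in> R \<and> x \<in> ?X r \<and> y \<in> ?Y r" by (cases r) simp
    then show ?thesis using unique by blast
  qed
  then have "\<forall>x\<in>{0..<n}. \<forall>y\<in>{0..<n}. \<exists>!r. r \<in> R \<and> x \<in> ?X r \<and> y \<in> ?Y r" by blast
  moreover have "\<forall>r\<in>R. ?X r \<subseteq> {0..<n} \<and> ?Y r \<subseteq> {0..<n} \<and> ?X r \<noteq> {} \<and> ?Y r \<noteq> {}"
  proof
    fix r assume "r \<in> R"
    from bspec[OF sides this] show "?X r \<subseteq> {0..<n} \<and> ?Y r \<subseteq> {0..<n} \<and> ?X r \<noteq> {} \<and> ?Y r \<noteq> {}"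
      by (cases r) simp
  qed
  ultimately show ?thesis using assms(1) by (simp only: partition2_def finite_atLeastLessThan_int simp_thms)
qed

lemma pair_mset_eq_iff: "{#a, b#} = {#c, d#} \<longleftrightarrow> a = c \<and> b = d \<or> a = d \<and> b = c"
  by (auto simp: add_eq_conv_ex)

text \<open>
  A rectangle is given as \<open>(a, b, c, d)\<close>, standing for \<open>[a, b] \<times> [c, d]\<close>. The set \<open>R\<close> is a
  dissection of \<open>[0, n]\<^sup>2\<close> into rectangles of pairwise distinct shapes.
\<close>

definition good_rectangles :: "int \<Rightarrow> (int \<times> int \<times> int \<times> int) set \<Rightarrow> bool" where
  "good_rectangles n R \<longleftrightarrow>
     partition2 {0..<n} R (\<lambda>(a, b, c, d). {a..<b}) (\<lambda>(a, b, c, d). {c..<d}) \<and>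
     inj_on (\<lambda>(a, b, c, d). {#nat (b - a), nat (d - c)#}) R"

lemma rectangles_4:
  assumes "n = 4 \<or> n = 5"
  shows "\<exists>R. good_rectangles n R \<and> card R = 4 \<and>
    (\<Sum>(a, b, c, d)\<in>R. nat (b - a) + nat (d - c)) = 3 * nat n + 4"
proof -
  let ?R = "{(0, n, 0, n - 3), (0, n - 1, n - 3, n), (n - 1, n, n - 3, n - 2), (n - 1, n, n - 2, n)}"
  have n: "4 \<le> n" using assms by auto
  have "partition2 {0..<n} ?R (\<lambda>(a, b, c, d). {a..<b}) (\<lambda>(a, b, c, d). {c..<d})"
  proof (rule partition2_rectanglesI)
    fix x y :: int assume "0 \<le> x" "x < n" "0 \<le> y" "y < n"
    then show "\<exists>(a, b, c, d)\<in>?R. a \<le> x \<and> x < b \<and> c \<le> y \<and> y < d" using n by (simp; linarith)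
  qed (use n in simp_all)
  moreover have "inj_on (\<lambda>(a, b, c, d). {#nat (b - a), nat (d - c)#}) ?R"
    using assms unfolding inj_on_def by (elim disjE) (simp_all add: pair_mset_eq_iff)
  moreover have "card ?R = 4" "(\<Sum>(a, b, c, d)\<in>?R. nat (b - a) + nat (d - c)) = 3 * nat n + 4"
    using assms by (elim disjE; simp)+
  ultimately show ?thesis unfolding good_rectangles_def by (intro exI[of _ ?R] conjI)
qed

lemma rectangles_5:
  assumes "4 \<le> n" "n \<le> 9"
  shows "\<exists>R. good_rectangles n R \<and> card R = 5 \<and>
    (\<Sum>(a, b, c, d)\<in>R. nat (b - a) + nat (d - c)) = 3 * nat n + 6"
proof (cases "n = 4")
  case True
  let ?R = "{(0, 3, 0, 2), (0, 2, 2, 4), (2, 3, 2, 4), (3, 4, 0, 3), (3, 4, 3, 4)}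
    :: (int \<times> int \<times> int \<times> int) set"
  have "partition2 {0..<n} ?R (\<lambda>(a, b, c, d). {a..<b}) (\<lambda>(a, b, c, d). {c..<d})"
  proof (rule partition2_rectanglesI)
    fix x y :: int assume "0 \<le> x" "x < n" "0 \<le> y" "y < n"
    then show "\<exists>(a, b, c, d)\<in>?R. a \<le> x \<and> x < b \<and> c \<le> y \<and> y < d" using True by (simp; linarith)
  qed (use True in simp_all)
  moreover have "inj_on (\<lambda>(a, b, c, d). {#nat (b - a), nat (d - c)#}) ?R"
    unfolding inj_on_def by (simp add: pair_mset_eq_iff)
  moreover have "card ?R = 5" "(\<Sum>(a, b, c, d)\<in>?R. nat (b - a) + nat (d - c)) = 3 * nat n + 6"
    using True by simp_all
  ultimately show ?thesis unfolding good_rectangles_def by (intro exI[of _ ?R] conjI)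
next
  case False
  let ?R = "{(0, n, 0, n - 2), (0, n - 3, n - 2, n), (n - 3, n, n - 2, n - 1),
    (n - 3, n - 2, n - 1, n), (n - 2, n, n - 1, n)}"
  have n: "5 \<le> n" using assms False by simp
  have n9: "n = 5 \<or> n = 6 \<or> n = 7 \<or> n = 8 \<or> n = 9" using n assms by presburger
  have "partition2 {0..<n} ?R (\<lambda>(a, b, c, d). {a..<b}) (\<lambda>(a, b, c, d). {c..<d})"
  proof (rule partition2_rectanglesI)
    fix x y :: int assume "0 \<le> x" "x < n" "0 \<le> y" "y < n"
    then show "\<exists>(a, b, c, d)\<in>?R. a \<le> x \<and> x < b \<and> c \<le> y \<and> y < d" using n by (simp; linarith)
  qed (use n in simp_all)
  moreover have "inj_on (\<lambda>(a, b, c, d). {#nat (b - a), nat (d - c)#}) ?R"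
    using n9 unfolding inj_on_def by (elim disjE) (simp_all add: pair_mset_eq_iff)
  moreover have "card ?R = 5" "(\<Sum>(a, b, c, d)\<in>?R. nat (b - a) + nat (d - c)) = 3 * nat n + 6"
    using n9 by (elim disjE; simp)+
  ultimately show ?thesis unfolding good_rectangles_def by (intro exI[of _ ?R] conjI)
qed

lemma square_tiling_of_rectangles:
  assumes R: "good_rectangles (int n) R" and n: "0 < n"
    and sum: "(\<Sum>(a, b, c, d)\<in>R. nat (b - a) + nat (d - c)) = 3 * n + w"
  shows "\<exists>T :: (real ^ 2) set set. tiling n T \<and> card T = card R \<and> distinct_dims T \<and> interface T = n + w"
proof -
  define x x' y y' :: "int \<times> int \<times> int \<times> int \<Rightarrow> int" where
    "x = (\<lambda>(a, b, c, d). a)" and "x' = (\<lambda>(a, b, c, d). b)"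
    and "y = (\<lambda>(a, b, c, d). c)" and "y' = (\<lambda>(a, b, c, d). d)"
  note xy = x_def x'_def y_def y'_def
  have "partition2 {0..<int n} R (\<lambda>i. {x i..<x' i}) (\<lambda>i. {y i..<y' i})"
    "inj_on (\<lambda>i. {#nat (x' i - x i), nat (y' i - y i)#}) R"
    using R by (simp_all add: good_rectangles_def xy case_prod_unfold)
  from square_tiling_exists[OF n this] obtain T :: "(real ^ 2) set set"
    where T: "tiling n T" "card T = card R" "distinct_dims T"
      "interface T + 2 * n = (\<Sum>i\<in>R. nat (x' i - x i) + nat (y' i - y i))" by blast
  have "(\<Sum>i\<in>R. nat (x' i - x i) + nat (y' i - y i)) = 3 * n + w"
    using sum by (simp add: xy case_prod_unfold)
  then have "interface T = n + w" using T(4) by linarith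
  then show ?thesis using T by blast
qed

text \<open>
  The dissection of the square becomes the bottom layer of height 1 of the cube, and the slab
  above it, of height \<open>n - 1\<close>, is the box with index \<^const>\<open>None\<close>.
\<close>

lemma partition3_add_slab:
  fixes n :: int
  assumes P: "partition2 {0..<n} I (\<lambda>i. {x i..<x' i}) (\<lambda>i. {y i..<y' i})" and n: "2 \<le> n"
  shows "partition3 {0..<n} (insert None (Some ` I))
    (\<lambda>j. {case_option 0 x j..<case_option n x' j}) (\<lambda>j. {case_option 0 y j..<case_option n y' j})
    (\<lambda>j. {case_option 1 (\<lambda>_. 0) j..<case_option n (\<lambda>_. 1) j})"
    (is "partition3 _ ?J ?X ?Y ?Z")
proof -
  have "\<exists>!j. j \<in> ?J \<and> u \<in> ?X j \<and> v \<in> ?Y j \<and> w \<in> ?Z j"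
    if uvw: "u \<in> {0..<n}" "v \<in> {0..<n}" "w \<in> {0..<n}" for u v w
  proof (cases "w = 0")
    case True
    obtain i where i: "i \<in> I" "u \<in> {x i..<x' i}" "v \<in> {y i..<y' i}"
      by (rule partition2_cell_covered[OF P uvw(1,2)])
    show ?thesis
    proof (rule ex1I[of _ "Some i"])
      show "Some i \<in> ?J \<and> u \<in> ?X (Some i) \<and> v \<in> ?Y (Some i) \<and> w \<in> ?Z (Some i)"
        using i True by simp
      fix j assume j: "j \<in> ?J \<and> u \<in> ?X j \<and> v \<in> ?Y j \<and> w \<in> ?Z j"
      then obtain i' where i': "j = Some i'" "i' \<in> I" "u \<in> {x i'..<x' i'}" "v \<in> {y i'..<y' i'}"
        using True by auto
      have "i' = i" by (rule partition2_cell_unique[OF P i'(2) i(1) i'(3) i(2) i'(4) i(3)])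
      then show "j = Some i" using i' by simp
    qed
  next
    case False
    then show ?thesis using uvw by (intro ex1I[of _ None]) auto
  qed
  then have "\<forall>u\<in>{0..<n}. \<forall>v\<in>{0..<n}. \<forall>w\<in>{0..<n}. \<exists>!j. j \<in> ?J \<and> u \<in> ?X j \<and> v \<in> ?Y j \<and> w \<in> ?Z j"
    by (intro ballI)
  moreover have "\<forall>j\<in>?J. ?X j \<subseteq> {0..<n} \<and> ?Y j \<subseteq> {0..<n} \<and> ?Z j \<subseteq> {0..<n} \<and>
      ?X j \<noteq> {} \<and> ?Y j \<noteq> {} \<and> ?Z j \<noteq> {}"
  proof
    fix j assume j: "j \<in> ?J"
    show "?X j \<subseteq> {0..<n} \<and> ?Y j \<subseteq> {0..<n} \<and> ?Z j \<subseteq> {0..<n} \<and>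
      ?X j \<noteq> {} \<and> ?Y j \<noteq> {} \<and> ?Z j \<noteq> {}"
    proof (cases j)
      case None
      then show ?thesis using n by simp
    next
      case (Some i)
      then have "i \<in> I" using j by auto
      from partition2_sides[OF P this] show ?thesis using Some n by simp
    qed
  qed
  moreover have "finite ?J" using P by (simp add: partition2_def)
  ultimately show ?thesis by (simp only: partition3_def finite_atLeastLessThan_int simp_thms)
qed

lemma cube_tiling_of_rectangles:
  assumes R: "good_rectangles (int n) R" and n: "3 \<le> n"
    and sum: "(\<Sum>(a, b, c, d)\<in>R. nat (b - a) + nat (d - c)) = 3 * n + w"
  shows "\<exists>T :: (real ^ 3) set set. tiling n T \<and> card T = Suc (card R) \<and> distinct_dims T \<and>
    interface T = n\<^sup>2 + n + w"
proof -
  define x x' y y' :: "int \<times> int \<times> int \<times> int \<Rightarrow> int" where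
    "x = (\<lambda>(a, b, c, d). a)" and "x' = (\<lambda>(a, b, c, d). b)"
    and "y = (\<lambda>(a, b, c, d). c)" and "y' = (\<lambda>(a, b, c, d). d)"
  note xy = x_def x'_def y_def y'_def
  have P: "partition2 {0..<int n} R (\<lambda>i. {x i..<x' i}) (\<lambda>i. {y i..<y' i})"
    and inj: "inj_on (\<lambda>i. {#nat (x' i - x i), nat (y' i - y i)#}) R"
    using R by (simp_all add: good_rectangles_def xy case_prod_unfold)
  let ?J = "insert None (Some ` R)"
  let ?x = "case_option 0 x" and ?x' = "case_option (int n) x'"
  let ?y = "case_option 0 y" and ?y' = "case_option (int n) y'"
  let ?z = "case_option 1 (\<lambda>_. 0) :: _ \<Rightarrow> int" and ?z' = "case_option (int n) (\<lambda>_. 1)"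
  have fin: "finite R" using P by (simp add: partition2_def)
  have nat_n: "nat (int n - 1) = n - 1" by simp
  have "inj_on (\<lambda>j. {#nat (?x' j - ?x j), nat (?y' j - ?y j), nat (?z' j - ?z j)#}) ?J"
  proof -
    have slab: "{#nat (x' i - x i), nat (y' i - y i), 1#} \<noteq> {#n, n, n - 1#}" for i
    proof
      assume "{#nat (x' i - x i), nat (y' i - y i), 1#} = {#n, n, n - 1#}"
      then have "1 \<in># {#n, n, n - 1#}" by (metis union_single_eq_member add_mset_commute)
      then show False using n by simp
    qed
    have layer: "i = j" if "i \<in> R" "j \<in> R"
      "{#nat (x' i - x i), nat (y' i - y i), 1#} = {#nat (x' j - x j), nat (y' j - y j), 1#}" for i j
    proof -
      have "add_mset 1 {#nat (x' i - x i), nat (y' i - y i)#} =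
          add_mset 1 {#nat (x' j - x j), nat (y' j - y j)#}"
        using that(3) by (simp add: add_mset_commute)
      then show ?thesis using inj that by (auto dest: inj_onD)
    qed
    show ?thesis using slab layer slab[symmetric] nat_n unfolding inj_on_def by auto
  qed
  moreover have "partition3 {0..<int n} ?J (\<lambda>j. {?x j..<?x' j}) (\<lambda>j. {?y j..<?y' j}) (\<lambda>j. {?z j..<?z' j})"
    by (rule partition3_add_slab[OF P]) (use n in simp)
  ultimately obtain T :: "(real ^ 3) set set" where T: "tiling n T" "card T = card ?J" "distinct_dims T"
    "interface T + 3 * n\<^sup>2 =
      (\<Sum>j\<in>?J. surface (\<lambda>j. {?x j..<?x' j}) (\<lambda>j. {?y j..<?y' j}) (\<lambda>j. {?z j..<?z' j}) j)"
    using cube_tiling_exists[of n ?J ?x ?x' ?y ?y' ?z ?z'] n by auto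
  have "(\<Sum>j\<in>?J. surface (\<lambda>j. {?x j..<?x' j}) (\<lambda>j. {?y j..<?y' j}) (\<lambda>j. {?z j..<?z' j}) j) =
      n * n + 2 * (n * (n - 1)) + (\<Sum>i\<in>R. nat (x' i - x i) * nat (y' i - y i)) +
      (\<Sum>i\<in>R. nat (x' i - x i) + nat (y' i - y i))"
    using fin by (simp add: sum.reindex sum.distrib nat_n mult.commute[of "n - Suc 0"])
  also have "(\<Sum>i\<in>R. nat (x' i - x i) * nat (y' i - y i)) = n * n"
    using partition2_area[OF P] by simp
  also have "(\<Sum>i\<in>R. nat (x' i - x i) + nat (y' i - y i)) = 3 * n + w"
    using sum by (simp add: xy case_prod_unfold)
  also have "n * (n - 1) = n\<^sup>2 - n" by (simp add: power2_eq_square diff_mult_distrib2)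
  finally have "interface T + 3 * n\<^sup>2 = n * n + 2 * (n\<^sup>2 - n) + n * n + (3 * n + w)"
    using T(4) by simp
  moreover have "n \<le> n\<^sup>2" by (simp add: power2_eq_square)
  ultimately have "interface T = n\<^sup>2 + n + w" unfolding power2_eq_square[symmetric] by linarith
  moreover have "card ?J = Suc (card R)" using fin by (simp add: card_image)
  ultimately show ?thesis using T by metis
qed

lemma rectangles_exist:
  assumes "small_case n m c"
  shows "\<exists>R. good_rectangles (int n) R \<and> card R = m \<and>
    (\<Sum>(a, b, c, d)\<in>R. nat (b - a) + nat (d - c)) = 3 * n + c"
  using assms rectangles_4[of "int n"] rectangles_5[of "int n"] by (auto simp: small_case_def)

lemma W_star_eq:
  assumes "small_case n m c"
  shows "W_star n m = n + c"
  unfolding W_star_def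
proof (rule cInf_eq_minimum)
  have n: "0 < n" using assms by (auto simp: small_case_def)
  obtain R where R: "good_rectangles (int n) R" "card R = m"
    "(\<Sum>(a, b, c, d)\<in>R. nat (b - a) + nat (d - c)) = 3 * n + c"
    using rectangles_exist[OF assms] by blast
  obtain T :: "(real ^ 2) set set" where "tiling n T" "card T = m" "distinct_dims T" "interface T = n + c"
    using square_tiling_of_rectangles[OF R(1) n R(3)] R(2) by blast
  then show "n + c \<in> {interface T | T :: (real ^ 2) set set. tiling n T \<and> card T = m \<and> distinct_dims T}"
    by (intro CollectI exI[of _ T]) simp
next
  fix w assume "w \<in> {interface T | T :: (real ^ 2) set set. tiling n T \<and> card T = m \<and> distinct_dims T}"
  then show "n + c \<le> w" using interface_square_lower assms by blast
qed

lemma I_min_eq: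
  assumes "small_case n m c"
  shows "I_min n (Suc m) = n\<^sup>2 + n + c"
  unfolding I_min_def
proof (rule cInf_eq_minimum)
  have n: "3 \<le> n" using assms by (auto simp: small_case_def)
  obtain R where R: "good_rectangles (int n) R" "card R = m"
    "(\<Sum>(a, b, c, d)\<in>R. nat (b - a) + nat (d - c)) = 3 * n + c"
    using rectangles_exist[OF assms] by blast
  obtain T :: "(real ^ 3) set set" where "tiling n T" "card T = Suc m" "distinct_dims T" "interface T = n\<^sup>2 + n + c"
    using cube_tiling_of_rectangles[OF R(1) n R(3)] R(2) by blast
  then show "n\<^sup>2 + n + c \<in> {interface T | T :: (real ^ 3) set set. tiling n T \<and> card T = Suc m \<and> distinct_dims T}"
    by (intro CollectI exI[of _ T]) simp
next
  fix w assume "w \<in> {interface T | T :: (real ^ 3) set set. tiling n T \<and> card T = Suc m \<and> distinct_dims T}"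
  then show "n\<^sup>2 + n + c \<le> w" using interface_cube_lower assms by blast
qed

theorem theorem4:
  shows "(\<forall>n\<in>{4, 5}. W_star n 4 = n + 4) \<and>
         (\<forall>n\<in>{4..9}. W_star n 5 = n + 6) \<and>
         (\<forall>n\<in>{4, 5}. I_min n 5 = n\<^sup>2 + n + 4) \<and>
         (\<forall>n\<in>{4..9}. I_min n 6 = n\<^sup>2 + n + 6)"
  using W_star_eq[of _ 4 4] W_star_eq[of _ 5 6] I_min_eq[of _ 4 4] I_min_eq[of _ 5 6]
  by (simp add: small_case_def)

end
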